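(* Let $S$ be a truncation set, let $R$ be a commutative (possibly non-unital) ring and let $0 \to I \to A \xrightarrow{\pi} R \to 0$ be an exact sequence (presentation) in which $A$ is a commutative (possibly non-unital) ring without $S$-torsion. Then there are a unique homeomorphism $\psi_S : R^S \to E_S(R,\pi)$ and a unique isomorphism of topological groups $\nu_{R,S} : \hat U_S(R) \to E_S(R,\pi)$ such that $$\psi_S \circ \pi^S = q \circ \Psi_S \quad\text{and}\quad \nu_{R,S} \circ \hat U_S(\pi) = q \circ \mu_{A,S},$$ where $\pi^S : A^S \to R^S$ and $\hat U_S(\pi) : \hat U_S(A) \to \hat U_S(R)$ are the maps induced by $\pi$ and $q : X_S(A) \to X_S(A)/X_S(I) = E_S(R,\pi)$ is the quotient map.
   Context: Rings are commutative and possibly non-unital. A truncation set is a non-empty subset $S \subset \mathbb{N} = \{1,2,3,\ldots\}$ such that every positive divisor of an element of $S$ lies in $S$. For $n \in S$ put $S/n = \{\nu \in \mathbb{N} \mid \nu n \in S\}$. A ring $A$ has no $S$-torsion if $nx = 0$ with $n\in S$, $x \in A$ implies $x = 0$. For a ring $A$ (with the discrete topology) $A^S$ is a ring under componentwise operations, with the product topology. For $n\in S$ define $V_n : A^{S/n} \to A^S$, $V_n((a_\nu)_{\nu\in S/n}) = n(\delta_{n\mid\nu} a_{\nu/n})_{\nu \in S}$, where $\delta_{n\mid\nu}=1$ if $n\mid\nu$ and $0$ otherwise. For $a\in A$ put $\langle a\rangle_S = (a^\nu)_{\nu\in S}\in A^S$ and $V_n\langle a\rangle = V_n(\langle a\rangle_{S/n})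 \in A^S$. $X_S(A)$ is the closed additive subgroup of $A^S$ generated by all $V_n\langle a\rangle$, $n\in S$, $a\in A$; it is a closed subring, and for an ideal $I\subset A$ (viewed as a ring) $X_S(I)$ is a closed ideal of $X_S(A)$. $E_S(R,\pi) = X_S(A)/X_S(I)$ with the quotient topology. Define $\Psi_S : A^S \to X_S(A)$ by the (convergent) series $\Psi_S((a_n)_{n\in S}) = \sum_{n\in S} V_n\langle a_n\rangle$, i.e. $\Psi_S((a_n))_m = \sum_{n\mid m} n a_n^{m/n}$ for $m \in S$. For a ring $A$ let $\hat U(A) = 1 + tA[[t]]$, a group under multiplication with the $t$-adic topology (if $A$ has no unit, embed $A$ in a unital ring and let $1$ be its unit). Let $H_S \subset \hat U(A)$ be the closed subgroup generated by all $1 - at^n$ with $a\in A$, $n\in\mathbb{N}\setminus S$, and $\hat U_S(A) = \hat U(A)/H_S$ with the quotient topology. The continuous homomorphism $\mu_A : \hat U(A) \to tA[[t]] \equiv A^{\mathbb{N}}$, $\mu_A(P) = -tP'/P$, takes values in $X_{\mathbb{N}}(A)$ and sends $1-at^n$ to $V_n\langle a\rangle$; composed with the projection $X_{\mathbb{N}}(A)\to X_S(A)$ it induces a continuous homomorphism $\mu_{A,S} : \hat U_S(A) \to X_S(A)$. *)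

theory Defs
  imports
    "HOL-Analysis.Analysis"
    "HOL-Algebra.Coset"
    "HOL-Algebra.Product_Groups"
    "HOL-Computational_Algebra.Formal_Power_Series"
begin

section \<open>Multiples and powers in a non-unital ring\<close>

text \<open>A commutative, possibly non-unital ring is a type of class \<^class>\<open>comm_ring\<close>. Such a type has
  neither \<open>of_nat\<close> nor \<open>^\<close>, so both operations are introduced here. Only exponents \<open>n \<ge> 1\<close> are
  meaningful; the value at exponent \<open>0\<close> is a dummy.\<close>

definition nmul :: "nat \<Rightarrow> 'a::comm_monoid_add \<Rightarrow> 'a" where
  "nmul n x = (\<Sum>i<n. x)"

fun npow :: "'a::comm_ring \<Rightarrow> nat \<Rightarrow> 'a" where
  "npow a 0 = 0"
| "npow a (Suc 0) = a"
| "npow a (Suc (Suc n)) = a * npow a (Suc n)"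

definition zmul :: "int \<Rightarrow> 'a::ab_group_add \<Rightarrow> 'a" where
  "zmul k x = nmul (nat k) x - nmul (nat (- k)) x"

lemma nmul_0 [simp]: "nmul 0 x = 0"
  and nmul_Suc [simp]: "nmul (Suc n) x = x + nmul n x"
  by (simp_all add: nmul_def add.commute)

lemma nmul_add: "nmul (m + n) x = nmul m x + nmul n x"
  by (induction m) (simp_all add: add.assoc)

lemma nmul_zero [simp]: "nmul n 0 = 0"
  by (induction n) simp_all

lemma nmul_plus: "nmul n (x + y) = nmul n x + nmul n y"
  by (simp add: nmul_def sum.distrib)

lemma nmul_minus: "nmul n (x - y) = nmul n x - nmul n (y :: 'a::ab_group_add)"
  by (simp add: nmul_def sum_subtractf)

lemma nmul_nmul: "nmul (m * n) x = nmul m (nmul n x)"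
  by (induction m) (simp_all add: nmul_add)

lemma nmul_mult_left: "nmul n x * y = nmul n (x * y :: 'a::comm_ring)"
  by (simp add: nmul_def sum_distrib_right)

lemma zmul_diff: "zmul (int m - int n) x = nmul m x - nmul n x"
proof (cases "n \<le> m")
  case True
  have "nmul m x = nmul ((m - n) + n) x" using True by simp
  then have "nmul m x = nmul (m - n) x + nmul n x" by (simp only: nmul_add)
  then show ?thesis using True
    by (simp add: zmul_def nat_diff_distrib)
next
  case False
  have "nmul n x = nmul ((n - m) + m) x" using False by simp
  then have "nmul n x = nmul (n - m) x + nmul m x" by (simp only: nmul_add)
  then show ?thesis using False
    by (simp add: zmul_def nat_diff_distrib)
qed

lemma zmul_0 [simp]: "zmul 0 x = 0"
  and zmul_1 [simp]: "zmul 1 x = x"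
  and zmul_zero [simp]: "zmul k 0 = 0"
  by (simp_all add: zmul_def)

lemma zmul_add: "zmul (k + l) x = zmul k x + zmul l x"
proof -
  obtain a b c d where kl: "k = int a - int b" "l = int c - int d"
    by (metis int_diff_cases)
  have "k + l = int (a + c) - int (b + d)" by (simp add: kl)
  then have "zmul (k + l) x = nmul (a + c) x - nmul (b + d) x" by (simp only: zmul_diff)
  then show ?thesis
    unfolding kl zmul_diff by (simp add: nmul_add algebra_simps)
qed

lemma zmul_plus: "zmul k (x + y) = zmul k x + zmul k y"
  by (simp add: zmul_def nmul_plus algebra_simps)

lemma zmul_zmul: "zmul (k * l) x = zmul k (zmul l x)"
proof -
  obtain a b c d where kl: "k = int a - int b" "l = int c - int d"
    by (metis int_diff_cases)
  have "k * l = int (a * c + b * d) - int (a * d + b * c)"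
    by (simp add: kl algebra_simps)
  then have "zmul (k * l) x = nmul (a * c + b * d) x - nmul (a * d + b * c) x"
    by (simp only: zmul_diff)
  also have "\<dots> = zmul k (zmul l x)"
    unfolding kl zmul_diff by (simp add: nmul_add nmul_nmul nmul_minus)
  finally show ?thesis .
qed

lemma zmul_mult_left: "zmul k x * y = zmul k (x * y :: 'a::comm_ring)"
  by (simp add: zmul_def nmul_mult_left left_diff_distrib)

lemma zmul_mult_right: "y * zmul k x = zmul k (y * x :: 'a::comm_ring)"
  using zmul_mult_left[of k x y] by (simp add: mult.commute)


section \<open>Adjoining a unit\<close>

text \<open>\<open>Adj k a\<close> stands for \<open>k \<cdot> 1 + a\<close>; the ring \<open>A\<close> embeds as the ideal of all \<open>Adj 0 a\<close>.\<close>

datatype 'a unitization = Adj (scalar_part: int) (ring_part: 'a)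

instantiation unitization :: (comm_ring) comm_ring_1
begin

definition "0 = Adj 0 0"
definition "1 = Adj 1 0"
definition "x + y = Adj (scalar_part x + scalar_part y) (ring_part x + ring_part y)"
definition "- x = Adj (- scalar_part x) (- ring_part x)"
definition "x - y = Adj (scalar_part x - scalar_part y) (ring_part x - ring_part y)"
definition "x * y = Adj (scalar_part x * scalar_part y)
  (zmul (scalar_part x) (ring_part y) + zmul (scalar_part y) (ring_part x)
    + ring_part x * ring_part y)"

instance
  by standard
    (auto simp: zero_unitization_def one_unitization_def plus_unitization_def
      uminus_unitization_def minus_unitization_def times_unitization_def
      zmul_add zmul_plus zmul_mult_left zmul_mult_right algebra_simps
      simp flip: zmul_zmul intro: unitization.expand)

end

definition emb :: "'a \<Rightarrow> 'a unitization" where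
  "emb a = Adj 0 a"

lemma emb_mult: "emb (a * b) = emb a * emb (b :: 'a::comm_ring)"
  by (simp add: emb_def times_unitization_def)

lemma emb_add: "emb (a + b) = emb a + emb (b :: 'a::comm_ring)"
  by (simp add: emb_def plus_unitization_def)


section \<open>Quotient topologies and topologically generated closed subgroups\<close>

definition quotient_topology :: "'a topology \<Rightarrow> ('a \<Rightarrow> 'b) \<Rightarrow> 'b topology" where
  "quotient_topology T f =
     topology (\<lambda>U. U \<subseteq> f ` topspace T \<and> openin T {x \<in> topspace T. f x \<in> U})"

lemma openin_quotient_topology:
  "openin (quotient_topology T f) U \<longleftrightarrow>
     U \<subseteq> f ` topspace T \<and> openin T {x \<in> topspace T. f x \<in> U}"
proof -
  have "istopology (\<lambda>U. U \<subseteq> f ` topspace T \<and> openin T {x \<in> topspace T. f x \<in> U})"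
    unfolding istopology_def
  proof (intro conjI allI impI; (elim conjE)?)
    fix U V
    assume "openin T {x \<in> topspace T. f x \<in> U}" "openin T {x \<in> topspace T. f x \<in> V}"
    then have "openin T ({x \<in> topspace T. f x \<in> U} \<inter> {x \<in> topspace T. f x \<in> V})"
      by (rule openin_Int)
    moreover have "{x \<in> topspace T. f x \<in> U} \<inter> {x \<in> topspace T. f x \<in> V}
        = {x \<in> topspace T. f x \<in> U \<inter> V}" by auto
    ultimately show "openin T {x \<in> topspace T. f x \<in> U \<inter> V}" by simp
  next
    fix K
    assume K: "\<forall>U\<in>K. U \<subseteq> f ` topspace T \<and> openin T {x \<in> topspace T. f x \<in> U}"
    then have "openin T (\<Union>U\<in>K. {x \<in> topspace T. f x \<in> U})" by blast
    moreover have "(\<Union>U\<in>K. {x \<in> topspace T. f x \<in> U}) = {x \<in> topspace T. f x \<in> \<Union>K}"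
      by auto
    ultimately show "openin T {x \<in> topspace T. f x \<in> \<Union>K}" by simp
    show "\<Union>K \<subseteq> f ` topspace T" using K by blast
  qed auto
  then show ?thesis
    by (simp add: quotient_topology_def)
qed

lemma quotient_map_quotient_topology: "quotient_map T (quotient_topology T f) f"
proof -
  have "topspace (quotient_topology T f) = f ` topspace T"
  proof
    show "topspace (quotient_topology T f) \<subseteq> f ` topspace T"
      using openin_quotient_topology openin_topspace by metis
    have "{x \<in> topspace T. f x \<in> f ` topspace T} = topspace T" by auto
    then show "f ` topspace T \<subseteq> topspace (quotient_topology T f)"
      by (intro openin_subset) (simp add: openin_quotient_topology)
  qed
  then show ?thesis
    by (simp add: quotient_map_def openin_quotient_topology)
qed

definition closed_subgroup_generated ::
    "('a, 'm) monoid_scheme \<Rightarrow> 'a topology \<Rightarrow> 'a set \<Rightarrow> 'a set" where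
  "closed_subgroup_generated G T B = (\<lambda>H. subgroup H G \<and> closedin T H) hull B"


section \<open>Truncation sets and presentations\<close>

definition truncation_set :: "nat set \<Rightarrow> bool" where
  "truncation_set S \<longleftrightarrow> S \<noteq> {} \<and> S \<subseteq> {0<..} \<and> (\<forall>n\<in>S. \<forall>d. d dvd n \<longrightarrow> d \<in> S)"

definition div_set :: "nat set \<Rightarrow> nat \<Rightarrow> nat set" where
  "div_set S n = {\<nu>. 0 < \<nu> \<and> \<nu> * n \<in> S}"

definition no_torsion :: "nat set \<Rightarrow> 'a::comm_ring set \<Rightarrow> bool" where
  "no_torsion S A \<longleftrightarrow> (\<forall>n\<in>S. \<forall>x\<in>A. nmul n x = 0 \<longrightarrow> x = 0)"

text \<open>Exactness of \<open>0 \<rightarrow> I \<rightarrow> A \<rightarrow> R \<rightarrow> 0\<close>, with \<open>I\<close> regarded as an ideal of \<open>A\<close>.\<close>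

definition presentation :: "'a::comm_ring set \<Rightarrow> ('a \<Rightarrow> 'r::comm_ring) \<Rightarrow> bool" where
  "presentation I \<pi> \<longleftrightarrow>
     (\<forall>x y. \<pi> (x + y) = \<pi> x + \<pi> y) \<and> (\<forall>x y. \<pi> (x * y) = \<pi> x * \<pi> y) \<and>
     I = {x. \<pi> x = 0} \<and> surj \<pi>"


section \<open>The groups $X_S$ and $E_S$\<close>

text \<open>Elements of \<open>J\<^sup>S\<close> are functions in \<open>S \<rightarrow>\<^sub>E J\<close>. The parameter \<open>J\<close> is the carrier of a (non-unital)
  subring of the ambient ring: \<^const>\<open>UNIV\<close> for the ring itself, or an ideal.\<close>

definition pow_group :: "nat set \<Rightarrow> 'a::comm_ring set \<Rightarrow> (nat \<Rightarrow> 'a) monoid" where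
  "pow_group S J = product_group S (\<lambda>_. \<lparr>carrier = J, monoid.mult = (+), one = 0\<rparr>)"

definition pow_topology :: "nat set \<Rightarrow> 'a set \<Rightarrow> (nat \<Rightarrow> 'a) topology" where
  "pow_topology S J = product_topology (\<lambda>_. discrete_topology J) S"

definition pow_map :: "nat set \<Rightarrow> ('a \<Rightarrow> 'r) \<Rightarrow> (nat \<Rightarrow> 'a) \<Rightarrow> nat \<Rightarrow> 'r" where
  "pow_map S \<pi> a = (\<lambda>n\<in>S. \<pi> (a n))"

definition teich :: "nat set \<Rightarrow> 'a::comm_ring \<Rightarrow> nat \<Rightarrow> 'a" where
  "teich S a = (\<lambda>\<nu>\<in>S. npow a \<nu>)"

definition Vmap :: "nat set \<Rightarrow> nat \<Rightarrow> (nat \<Rightarrow> 'a::comm_ring) \<Rightarrow> nat \<Rightarrow> 'a" where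
  "Vmap S n a = (\<lambda>\<nu>\<in>S. if n dvd \<nu> then nmul n (a (\<nu> div n)) else 0)"

definition XS :: "nat set \<Rightarrow> 'a::comm_ring set \<Rightarrow> (nat \<Rightarrow> 'a) set" where
  "XS S J = closed_subgroup_generated (pow_group S J) (pow_topology S J)
     {Vmap S n (teich (div_set S n) a) | n a. n \<in> S \<and> a \<in> J}"

definition XS_group :: "nat set \<Rightarrow> 'a::comm_ring set \<Rightarrow> (nat \<Rightarrow> 'a) monoid" where
  "XS_group S J = (pow_group S J)\<lparr>carrier := XS S J\<rparr>"

definition XS_topology :: "nat set \<Rightarrow> 'a::comm_ring set \<Rightarrow> (nat \<Rightarrow> 'a) topology" where
  "XS_topology S J = subtopology (pow_topology S J) (XS S J)"

definition E_group :: "nat set \<Rightarrow> 'a::comm_ring set \<Rightarrow> (nat \<Rightarrow> 'a) set monoid" where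
  "E_group S I = XS_group S UNIV Mod XS S I"

definition E_proj :: "nat set \<Rightarrow> 'a::comm_ring set \<Rightarrow> (nat \<Rightarrow> 'a) \<Rightarrow> (nat \<Rightarrow> 'a) set" where
  "E_proj S I x = XS S I #>\<^bsub>XS_group S UNIV\<^esub> x"

definition E_topology :: "nat set \<Rightarrow> 'a::comm_ring set \<Rightarrow> (nat \<Rightarrow> 'a) set topology" where
  "E_topology S I = quotient_topology (XS_topology S UNIV) (E_proj S I)"

definition Psi :: "nat set \<Rightarrow> (nat \<Rightarrow> 'a::comm_ring) \<Rightarrow> nat \<Rightarrow> 'a" where
  "Psi S a = (\<lambda>m\<in>S. \<Sum>n | n dvd m. nmul n (npow (a n) (m div n)))"

text \<open>\<^const>\<open>Psi\<close> is the sum of the series $\sum_{n\in S} V_n\langle a_n\rangle$ in the topology of \<open>A\<^sup>S\<close>.\<close>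

lemma Psi_series:
  fixes a :: "nat \<Rightarrow> 'a::comm_ring"
  assumes "truncation_set S"
  shows "limitin (pow_topology S UNIV)
           (\<lambda>F. \<lambda>m\<in>S. \<Sum>n\<in>F. Vmap S n (teich (div_set S n) (a n)) m)
           (Psi S a) (finite_subsets_at_top S)"
  unfolding pow_topology_def limitin_componentwise
proof (intro conjI ballI)
  show "Psi S a \<in> extensional S" by (simp add: Psi_def)
  show "\<forall>\<^sub>F F in finite_subsets_at_top S.
      (\<lambda>m\<in>S. \<Sum>n\<in>F. Vmap S n (teich (div_set S n) (a n)) m)
      \<in> topspace (product_topology (\<lambda>_. discrete_topology (UNIV::'a set)) S)"
    by (intro always_eventually) auto
next
  fix m assume m: "m \<in> S"
  define D where "D = {n. n dvd m}"
  have m0: "m > 0" and DS: "D \<subseteq> S" using assms m by (auto simp: truncation_set_def D_def)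
  have fD: "finite D" using m0 by (simp add: D_def)
  have summand: "Vmap S n (teich (div_set S n) (a n)) m
      = (if n \<in> D then nmul n (npow (a n) (m div n)) else 0)" for n
    using m m0 by (auto simp: Vmap_def teich_def div_set_def D_def dvd_div_eq_0_iff)
  have eq: "(\<lambda>m\<in>S. \<Sum>n\<in>F. Vmap S n (teich (div_set S n) (a n)) m) m = Psi S a m"
    if F: "finite F" "D \<subseteq> F" for F
  proof -
    have "(\<Sum>n\<in>F. Vmap S n (teich (div_set S n) (a n)) m)
        = (\<Sum>n\<in>D. nmul n (npow (a n) (m div n)))"
      unfolding summand using F by (intro sum.mono_neutral_cong_right) auto
    then show ?thesis using m by (simp add: Psi_def D_def)
  qed
  have "\<forall>\<^sub>F F in finite_subsets_at_top S.
      (\<lambda>m\<in>S. \<Sum>n\<in>F. Vmap S n (teich (div_set S n) (a n)) m) m = Psi S a m"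
    unfolding eventually_finite_subsets_at_top using fD DS eq by blast
  then show "limitin (discrete_topology UNIV)
      (\<lambda>F. (\<lambda>m\<in>S. \<Sum>n\<in>F. Vmap S n (teich (div_set S n) (a n)) m) m)
      (Psi S a m) (finite_subsets_at_top S)"
    by (intro limitin_eventually) auto
qed


section \<open>The groups $\hat U$ and $\hat U_S$\<close>

text \<open>\<open>1 + tA[[t]]\<close> is realised inside the power series over the unitization of \<open>A\<close>; the topology of
  the type \<open>fps\<close> is the \<open>t\<close>-adic one. The result does not depend on the unital ring used: the
  product of \<open>1 + f\<close> and \<open>1 + g\<close> is \<open>1 + (f + g + f g)\<close>.\<close>

definition Uhat :: "'a::comm_ring unitization fps monoid" where
  "Uhat = \<lparr>carrier = {P. fps_nth P 0 = 1 \<and> (\<forall>n>0. fps_nth P n \<in> range emb)},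
           monoid.mult = (*), one = 1\<rparr>"

definition Uhat_topology :: "'a::comm_ring unitization fps topology" where
  "Uhat_topology = top_of_set (carrier Uhat)"

definition Uhat_map ::
    "('a::comm_ring \<Rightarrow> 'r::comm_ring) \<Rightarrow> 'a unitization fps \<Rightarrow> 'r unitization fps" where
  "Uhat_map \<pi> P = Abs_fps (\<lambda>n. map_unitization \<pi> (fps_nth P n))"

definition HS :: "nat set \<Rightarrow> 'a::comm_ring unitization fps set" where
  "HS S = closed_subgroup_generated Uhat Uhat_topology
     {1 - fps_const (emb a) * fps_X ^ n | a n. n > 0 \<and> n \<notin> S}"

definition UhatS_proj ::
    "nat set \<Rightarrow> 'a::comm_ring unitization fps \<Rightarrow> 'a unitization fps set" where
  "UhatS_proj S P = HS S #>\<^bsub>Uhat\<^esub> P"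

definition UhatS :: "nat set \<Rightarrow> 'a::comm_ring unitization fps set monoid" where
  "UhatS S = Uhat Mod HS S"

definition UhatS_topology :: "nat set \<Rightarrow> 'a::comm_ring unitization fps set topology" where
  "UhatS_topology S = quotient_topology Uhat_topology (UhatS_proj S)"

text \<open>The map induced on cosets by a function that is constant on each coset.\<close>

definition induced :: "('a \<Rightarrow> 'b) \<Rightarrow> 'a set \<Rightarrow> 'b" where
  "induced f C = the_elem (f ` C)"

definition UhatS_map ::
    "nat set \<Rightarrow> ('a::comm_ring \<Rightarrow> 'r::comm_ring) \<Rightarrow> 'a unitization fps set \<Rightarrow> 'r unitization fps set" where
  "UhatS_map S \<pi> = induced (\<lambda>P. UhatS_proj S (Uhat_map \<pi> P))"

text \<open>The identification of \<open>tA[[t]]\<close> with \<open>A\<^sup>\<nat>\<close> reads off the coefficients of \<open>t\<^sup>n\<close>, \<open>n \<ge> 1\<close>.\<close>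

definition mu :: "'a::comm_ring unitization fps \<Rightarrow> nat \<Rightarrow> 'a" where
  "mu P = (\<lambda>n\<in>{0<..}. ring_part (fps_nth (- (fps_X * fps_deriv P * inv\<^bsub>Uhat\<^esub> P)) n))"

definition muS :: "nat set \<Rightarrow> 'a::comm_ring unitization fps set \<Rightarrow> nat \<Rightarrow> 'a" where
  "muS S = induced (\<lambda>P. restrict (mu P) S)"

end

theory Submission
  imports Defs
begin

text \<open>
  Every power series in \<open>1 + tA[[t]]\<close> has a unique expansion \<open>\<Prod>\<^sub>n (1 - a\<^sub>n t\<^sup>n)\<close>
  (\<open>fps_agree_Wprod_iff\<close>, \<open>Uhat_on_eq_range_Wprod\<close>), over any ring and continuously in both
  directions: the coefficients up to \<open>t\<^sup>n\<close> and the entries up to \<open>a\<^sub>n\<close> determine each other. In these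
  coordinates the homomorphism \<open>\<mu>\<close> is the map \<open>\<Psi>\<close> (\<open>ghost_Wprod\<close>). So the images of \<open>\<Psi>\<^sub>S\<close> on \<open>A\<^sup>S\<close> and \<open>I\<^sup>S\<close>
  are groups, and without torsion they are closed and equal \<open>X\<^sub>S(A)\<close> and \<open>X\<^sub>S(I)\<close>
  (\<open>XS_eq_ghost_image\<close>); also \<open>\<Psi>\<^sub>S\<close> is injective, because its \<open>m\<close>-th component is \<open>m a\<^sub>m\<close> plus terms in
  earlier entries.

  Two sequences over \<open>A\<close> have the same image in \<open>E\<^sub>S\<close> exactly if they agree modulo \<open>I\<close>
  (\<open>E_proj_Psi_eq_iff\<close>): reducing a product expansion modulo \<open>I\<close> reduces its entries, and the kernel of
  the reduction of power series is $\hat U(I)$. Hence \<open>q \<circ> \<Psi>\<^sub>S\<close> and \<open>\<pi>\<^sup>S\<close> have the same fibres. Moreover \<open>H\<^sub>S(R)\<close>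
  consists of the products whose entries vanish on \<open>S\<close> (\<open>HS_eq\<close>). It follows that a power series over
  \<open>A\<close> dies in $\hat U_S(R)$ if and only if it dies in \<open>E\<^sub>S\<close> (\<open>Uhat_map_mem_HS_iff\<close>), so the two
  homomorphisms from $\hat U(A)$ have the same fibres too.

  Each of these four maps is a topological quotient map: it is either a map with a continuous section
  or such a map followed by the projection to a space of cosets. Quotient maps from one space with
  the same fibres have canonically homeomorphic targets (\<open>quotient_maps_with_same_fibres\<close>), which
  gives \<open>\<psi>\<^sub>S\<close> and \<open>\<nu>\<close> with their uniqueness; \<open>\<nu>\<close> is additive because it is induced by homomorphisms from a group that surjects onto
  its domain.
\<close>

section \<open>Topologies of eventual agreement\<close>

definition agree :: "nat set \<Rightarrow> nat \<Rightarrow> (nat \<Rightarrow> 'a) \<Rightarrow> (nat \<Rightarrow> 'a) \<Rightarrow> bool" where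
  "agree S n a b \<longleftrightarrow> (\<forall>k\<in>S. k \<le> n \<longrightarrow> a k = b k)"

text \<open>The \<open>t\<close>-adic topology on power series and the product of discrete topologies on sequences are
  both given by a chain of equivalence relations "equal up to index \<open>n\<close>". Treating them through the
  chain alone lets a map be shown continuous by checking that it preserves each relation.\<close>

definition agreement_topology :: "'x topology \<Rightarrow> (nat \<Rightarrow> 'x \<Rightarrow> 'x \<Rightarrow> bool) \<Rightarrow> bool" where
  "agreement_topology T e \<longleftrightarrow> (\<forall>n. equivp (e n)) \<and>
     (\<forall>U. openin T U \<longleftrightarrow>
        U \<subseteq> topspace T \<and> (\<forall>x\<in>U. \<exists>n. \<forall>y\<in>topspace T. e n x y \<longrightarrow> y \<in> U))"

lemma agree_refl [simp]: "agree S n a a"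
  by (simp add: agree_def)

lemma agree_sym: "agree S n a b \<Longrightarrow> agree S n b a"
  by (simp add: agree_def)

lemma agree_trans: "agree S n a b \<Longrightarrow> agree S n b c \<Longrightarrow> agree S n a c"
  by (simp add: agree_def)

lemma agree_mono: "agree S n a b \<Longrightarrow> m \<le> n \<Longrightarrow> agree S m a b"
  by (simp add: agree_def)

lemma agree_all_imp_eq:
  assumes "\<And>n. agree S n a b" "a \<in> extensional S" "b \<in> extensional S"
  shows "a = b"
proof (rule extensionalityI[OF assms(2,3)])
  show "a k = b k" if "k \<in> S" for k
    using assms(1)[of k] that by (simp add: agree_def)
qed

lemma closedin_agreement_iff:
  assumes "agreement_topology T e"
  shows "closedin T C \<longleftrightarrow>
    C \<subseteq> topspace T \<and> (\<forall>x\<in>topspace T. (\<forall>n. \<exists>y\<in>C. e n x y) \<longrightarrow> x \<in> C)"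
proof -
  have "openin T (topspace T - C) \<longleftrightarrow>
      (\<forall>x\<in>topspace T - C. \<exists>n. \<forall>y\<in>topspace T. e n x y \<longrightarrow> y \<in> topspace T - C)"
    using assms by (simp add: agreement_topology_def)
  also have "\<dots> \<longleftrightarrow> (\<forall>x\<in>topspace T. (\<forall>n. \<exists>y\<in>topspace T \<inter> C. e n x y) \<longrightarrow> x \<in> C)"
    by blast
  finally have "openin T (topspace T - C) \<longleftrightarrow>
      (\<forall>x\<in>topspace T. (\<forall>n. \<exists>y\<in>topspace T \<inter> C. e n x y) \<longrightarrow> x \<in> C)" .
  then show ?thesis
    unfolding closedin_def by (simp add: Int_absorb1 cong: conj_cong)
qed

text \<open>An open set of the subspace extends to the whole space because the classes of \<open>e n\<close> are
  open: transitivity makes every point of a class an interior point.\<close>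

lemma agreement_subtopology:
  assumes T: "agreement_topology T e"
  shows "agreement_topology (subtopology T C) e"
proof -
  have eq: "equivp (e n)" for n using T by (simp add: agreement_topology_def)
  have op: "openin T U \<longleftrightarrow>
        U \<subseteq> topspace T \<and> (\<forall>x\<in>U. \<exists>n. \<forall>y\<in>topspace T. e n x y \<longrightarrow> y \<in> U)" for U
    using T by (simp add: agreement_topology_def)
  have "openin (subtopology T C) U \<longleftrightarrow>
        U \<subseteq> topspace T \<inter> C \<and> (\<forall>x\<in>U. \<exists>n. \<forall>y\<in>topspace T \<inter> C. e n x y \<longrightarrow> y \<in> U)"
    (is "?L \<longleftrightarrow> ?R") for U
  proof
    assume ?L
    then obtain V where "openin T V" "U = V \<inter> C" by (auto simp: openin_subtopology)
    then show ?R using op[of V] by blast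
  next
    assume R: ?R
    \<comment> \<open>The saturation of \<open>U\<close> by all the agreement classes that meet \<open>C\<close> inside \<open>U\<close>.\<close>
    define V where "V = {z \<in> topspace T. \<exists>x\<in>U. \<exists>n. e n x z \<and>
        (\<forall>y\<in>topspace T \<inter> C. e n x y \<longrightarrow> y \<in> U)}"
    have "openin T V"
      unfolding op
    proof (intro conjI ballI)
      show "V \<subseteq> topspace T" by (auto simp: V_def)
      fix z assume "z \<in> V"
      then obtain x n where *: "x \<in> U" "e n x z" "\<forall>y\<in>topspace T \<inter> C. e n x y \<longrightarrow> y \<in> U"
        by (auto simp: V_def)
      have "y \<in> V" if "y \<in> topspace T" "e n z y" for y
        unfolding V_def using * that equivp_transp[OF eq *(2) that(2)] by blast
      then show "\<exists>n. \<forall>y\<in>topspace T. e n z y \<longrightarrow> y \<in> V" by blast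
    qed
    moreover have "U = V \<inter> C"
    proof
      show "U \<subseteq> V \<inter> C"
      proof
        fix x assume "x \<in> U"
        then show "x \<in> V \<inter> C"
          using R equivp_reflp[OF eq] unfolding V_def by fast
      qed
      show "V \<inter> C \<subseteq> U" by (auto simp: V_def)
    qed
    ultimately show ?L by (auto simp: openin_subtopology)
  qed
  with eq show ?thesis by (simp add: agreement_topology_def)
qed

lemma continuous_map_agreement:
  assumes T: "agreement_topology T e" and T': "agreement_topology T' e'"
    and f: "\<And>x. x \<in> topspace T \<Longrightarrow> f x \<in> topspace T'"
    and e: "\<And>n x y. x \<in> topspace T \<Longrightarrow> y \<in> topspace T \<Longrightarrow> e n x y \<Longrightarrow> e' n (f x) (f y)"
  shows "continuous_map T T' f"
  unfolding continuous_map_def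
proof (intro conjI allI impI)
  show "f \<in> topspace T \<rightarrow> topspace T'" using f by blast
  fix U assume "openin T' U"
  then have U: "\<forall>x\<in>U. \<exists>n. \<forall>y\<in>topspace T'. e' n x y \<longrightarrow> y \<in> U"
    using T' by (simp add: agreement_topology_def)
  have "\<exists>n. \<forall>y\<in>topspace T. e n x y \<longrightarrow> f y \<in> U" if "x \<in> topspace T" "f x \<in> U" for x
    using U e f that by metis
  then show "openin T {x \<in> topspace T. f x \<in> U}"
    using T by (simp add: agreement_topology_def)
qed

text \<open>A surjection with a continuous section is a quotient map. The sections used below
  preserve every level of agreement, as the surjections do.\<close>

lemma quotient_map_agreement:
  assumes T: "agreement_topology T e" and T': "agreement_topology T' e'"
    and f: "\<And>x. x \<in> topspace T \<Longrightarrow> f x \<in> topspace T'"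
    and e: "\<And>n x y. x \<in> topspace T \<Longrightarrow> y \<in> topspace T \<Longrightarrow> e n x y \<Longrightarrow> e' n (f x) (f y)"
    and g: "\<And>x. x \<in> topspace T' \<Longrightarrow> g x \<in> topspace T"
    and e': "\<And>n x y. x \<in> topspace T' \<Longrightarrow> y \<in> topspace T' \<Longrightarrow> e' n x y \<Longrightarrow> e n (g x) (g y)"
    and fg: "\<And>y. y \<in> topspace T' \<Longrightarrow> f (g y) = y"
  shows "quotient_map T T' f"
proof (rule retraction_imp_quotient_map)
  have "continuous_map T T' f" using T T' f e by (rule continuous_map_agreement)
  moreover have "continuous_map T' T g" using T' T g e' by (rule continuous_map_agreement)
  ultimately show "retraction_map T T' f"
    unfolding retraction_map_def retraction_maps_def using fg by blast
qed

lemma topspace_pow_topology [simp]: "topspace (pow_topology S J) = S \<rightarrow>\<^sub>E J"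
  by (simp add: pow_topology_def)

text \<open>A basic open set of the product constrains finitely many coordinates, and a finite set of
  indices is bounded, so agreement up to a bound controls it.\<close>

lemma agreement_pow_topology: "agreement_topology (pow_topology S J) (agree S)"
  unfolding agreement_topology_def
proof (intro conjI allI)
  show "equivp (agree S n :: (nat \<Rightarrow> 'a) \<Rightarrow> _)" for n
    by (intro equivpI reflpI sympI transpI) (auto intro: agree_sym agree_trans)
  fix U :: "(nat \<Rightarrow> 'a) set"
  show "openin (pow_topology S J) U \<longleftrightarrow> U \<subseteq> topspace (pow_topology S J) \<and>
      (\<forall>x\<in>U. \<exists>n. \<forall>y\<in>topspace (pow_topology S J). agree S n x y \<longrightarrow> y \<in> U)" (is "?L \<longleftrightarrow> ?R")
  proof
    assume L: ?L
    have "\<exists>n. \<forall>y\<in>S \<rightarrow>\<^sub>E J. agree S n x y \<longrightarrow> y \<in> U" if "x \<in> U" for x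
    proof -
      obtain V where V: "finite {i \<in> S. V i \<noteq> J}" "\<And>i. i \<in> S \<Longrightarrow> V i \<subseteq> J"
          "x \<in> Pi\<^sub>E S V" "Pi\<^sub>E S V \<subseteq> U"
        using L \<open>x \<in> U\<close> unfolding pow_topology_def openin_product_topology_alt by auto
      obtain n where n: "\<And>i. i \<in> S \<Longrightarrow> V i \<noteq> J \<Longrightarrow> i \<le> n"
        using V(1) finite_nat_set_iff_bounded_le by (metis (mono_tags, lifting) mem_Collect_eq)
      have "y \<in> Pi\<^sub>E S V" if "y \<in> S \<rightarrow>\<^sub>E J" "agree S n x y" for y
      proof (rule PiE_I)
        show "y i \<in> V i" if "i \<in> S" for i
          using \<open>y \<in> S \<rightarrow>\<^sub>E J\<close> \<open>agree S n x y\<close> V(3) n[OF that] that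
          by (cases "V i = J") (auto simp: agree_def PiE_iff)
      qed (use that in \<open>auto simp: PiE_iff extensional_def\<close>)
      then show ?thesis using V(4) by blast
    qed
    then show ?R using openin_subset[OF L] by simp
  next
    assume R: ?R
    show ?L
      unfolding pow_topology_def openin_product_topology_alt
    proof (intro ballI)
      fix x assume "x \<in> U"
      then obtain n where n: "\<forall>y\<in>S \<rightarrow>\<^sub>E J. agree S n x y \<longrightarrow> y \<in> U" and x: "x \<in> S \<rightarrow>\<^sub>E J"
        using R by (metis subsetD topspace_pow_topology)
      define V where "V i = (if i \<le> n then {x i} else J)" for i
      have "finite {i \<in> S. V i \<noteq> topspace (discrete_topology J)}"
        by (rule finite_subset[of _ "{..n}"]) (auto simp: V_def)
      moreover have "\<forall>i\<in>S. openin (discrete_topology J) (V i)" "x \<in> Pi\<^sub>E S V"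
        using x by (auto simp: V_def)
      moreover have "Pi\<^sub>E S V \<subseteq> U"
      proof
        fix y assume y: "y \<in> Pi\<^sub>E S V"
        have "V i \<subseteq> J" if "i \<in> S" for i using x that by (auto simp: V_def)
        then have "y \<in> S \<rightarrow>\<^sub>E J" using y PiE_mono by blast
        moreover have "y i = x i" if "i \<in> S" "i \<le> n" for i
          using PiE_mem[OF y that(1)] that(2) by (simp add: V_def)
        then have "agree S n x y" by (simp add: agree_def)
        ultimately show "y \<in> U" using n by blast
      qed
      ultimately show "\<exists>V. finite {i \<in> S. V i \<noteq> topspace (discrete_topology J)} \<and>
          (\<forall>i\<in>S. openin (discrete_topology J) (V i)) \<and> x \<in> Pi\<^sub>E S V \<and> Pi\<^sub>E S V \<subseteq> U"
        by blast
    qed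
  qed
qed

abbreviation fps_agree :: "nat \<Rightarrow> 'a fps \<Rightarrow> 'a fps \<Rightarrow> bool" where
  "fps_agree n P Q \<equiv> agree UNIV n (fps_nth P) (fps_nth Q)"

lemma fps_agree_all_imp_eq:
  assumes "\<And>n. fps_agree n P Q"
  shows "P = Q"
proof (rule fps_ext)
  show "fps_nth P n = fps_nth Q n" for n
    using assms[of n] by (auto simp: agree_def)
qed

lemma fps_agree_iff_dist:
  "fps_agree n P Q \<longleftrightarrow> dist P Q < inverse (2 ^ n)" for P Q :: "'a::comm_ring_1 fps"
proof (cases "P = Q")
  case False
  have "fps_agree n P Q \<longleftrightarrow> n < subdegree (P - Q)"
  proof
    assume "fps_agree n P Q"
    moreover have "fps_nth P (subdegree (P - Q)) \<noteq> fps_nth Q (subdegree (P - Q))"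
      using nth_subdegree_nonzero[of "P - Q"] False by auto
    ultimately show "n < subdegree (P - Q)"
      unfolding agree_def by (meson UNIV_I not_le)
  next
    assume "n < subdegree (P - Q)"
    then show "fps_agree n P Q"
      using nth_less_subdegree_zero[of _ "P - Q"] by (auto simp: agree_def)
  qed
  then show ?thesis using False by (simp add: dist_fps_def)
qed simp

lemma agreement_fps: "agreement_topology (euclidean :: 'a::comm_ring_1 fps topology) fps_agree"
  unfolding agreement_topology_def
proof (intro conjI allI)
  show "equivp (fps_agree n :: 'a fps \<Rightarrow> _)" for n
    by (intro equivpI reflpI sympI transpI) (auto intro: agree_sym agree_trans)
  fix U :: "'a fps set"
  have "(\<exists>r>0. {y. dist y x < r} \<subseteq> U) \<longleftrightarrow> (\<exists>n. \<forall>y. fps_agree n x y \<longrightarrow> y \<in> U)" for x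
  proof
    assume "\<exists>r>0. {y. dist y x < r} \<subseteq> U"
    then obtain r where r: "r > 0" "{y. dist y x < r} \<subseteq> U" by blast
    obtain n where "inverse (2 ^ n) < r"
      using real_arch_pow_inv[of r "1/2"] r(1) by (auto simp: power_one_over inverse_eq_divide)
    then show "\<exists>n. \<forall>y. fps_agree n x y \<longrightarrow> y \<in> U"
      using r(2) unfolding fps_agree_iff_dist
      by (intro exI[of _ n]) (auto simp: dist_commute subset_iff)
  next
    assume "\<exists>n. \<forall>y. fps_agree n x y \<longrightarrow> y \<in> U"
    then obtain n where "\<forall>y. fps_agree n x y \<longrightarrow> y \<in> U" by blast
    then show "\<exists>r>0. {y. dist y x < r} \<subseteq> U"
      unfolding fps_agree_iff_dist
      by (intro exI[of _ "inverse (2 ^ n)"]) (auto simp: dist_commute)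
  qed
  then show "openin euclidean U \<longleftrightarrow> U \<subseteq> topspace euclidean \<and>
      (\<forall>x\<in>U. \<exists>n. \<forall>y\<in>topspace euclidean. fps_agree n x y \<longrightarrow> y \<in> U)"
    by (simp add: open_fps_def)
qed

lemma agreement_Uhat_topology: "agreement_topology Uhat_topology fps_agree"
  unfolding Uhat_topology_def by (rule agreement_subtopology[OF agreement_fps])

lemma topspace_Uhat_topology [simp]: "topspace Uhat_topology = carrier Uhat"
  by (simp add: Uhat_topology_def)

text \<open>Sequences whose images approximate a point to higher and higher levels are glued along their
  diagonal: agreement of the images forces the sequences to agree to the same level.\<close>

lemma agreement_glue:
  assumes eq: "\<And>n. equivp (e n)" and mono: "\<And>m n x y. e n x y \<Longrightarrow> m \<le> n \<Longrightarrow> e m x y"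
    and T: "\<And>n a b. e n (T a) (T b) \<longleftrightarrow> agree S n a b"
    and ex: "\<And>n. \<exists>a. (\<forall>k. a k \<in> J) \<and> e n (T a) x"
  shows "\<exists>a. (\<forall>k. a k \<in> J) \<and> (\<forall>n. e n (T a) x)"
proof -
  obtain A where A: "\<And>n k. A n k \<in> J" "\<And>n. e n (T (A n)) x"
    using ex by metis
  have "agree S m (A m) (A n)" if "m \<le> n" for m n
  proof -
    have "e m (T (A n)) x" using mono[OF A(2) that] .
    then have "e m (T (A m)) (T (A n))"
      using equivp_transp[OF eq A(2)] equivp_symp[OF eq] by blast
    then show ?thesis by (simp add: T)
  qed
  then have "agree S n (\<lambda>k. A k k) (A n)" for n by (simp add: agree_def)
  then have "e n (T (\<lambda>k. A k k)) (T (A n))" for n by (simp add: T)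
  then have "e n (T (\<lambda>k. A k k)) x" for n
    using equivp_transp[OF eq _ A(2)] by blast
  then show ?thesis using A(1) by (intro exI[of _ "\<lambda>k. A k k"]) blast
qed

text \<open>Both spaces carry the quotient topology of \<open>X\<close> for the same equivalence relation. This is how
  both maps of the main theorem arise.\<close>

lemma quotient_maps_with_same_fibres:
  assumes f: "quotient_map X Y f" and g: "quotient_map X Z g"
    and fg: "\<And>x y. x \<in> topspace X \<Longrightarrow> y \<in> topspace X \<Longrightarrow> f x = f y \<longleftrightarrow> g x = g y"
  shows "\<exists>!h. h \<in> extensional (topspace Y) \<and> homeomorphic_map Y Z h \<and>
            (\<forall>x\<in>topspace X. h (f x) = g x)"
proof -
  obtain h0 where h0: "continuous_map Y Z h0" "\<And>x. x \<in> topspace X \<Longrightarrow> h0 (f x) = g x"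
    using quotient_map_lift_exists[OF f quotient_imp_continuous_map[OF g]] fg by metis
  define h where "h = restrict h0 (topspace Y)"
  have surj: "f ` topspace X = topspace Y"
    using f by (simp add: quotient_imp_surjective_map)
  have hf: "h (f x) = g x" if "x \<in> topspace X" for x
    using h0(2)[OF that] surj that unfolding h_def by auto
  have "quotient_map X Z (h \<circ> f)"
    using g by (rule quotient_map_eq) (simp add: hf)
  then have "quotient_map Y Z h"
    using quotient_map_compose_eq[OF f] by blast
  moreover have "inj_on h (topspace Y)"
    unfolding surj[symmetric] by (intro inj_onI) (use fg hf in auto)
  ultimately have "homeomorphic_map Y Z h"
    by (simp add: homeomorphic_map_def)
  moreover have "h \<in> extensional (topspace Y)" by (simp add: h_def)
  moreover have "h' = h"
    if "h' \<in> extensional (topspace Y)" "\<forall>x\<in>topspace X. h' (f x) = g x" for h'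
  proof (rule extensionalityI[OF that(1) \<open>h \<in> extensional (topspace Y)\<close>])
    show "h' y = h y" if "y \<in> topspace Y" for y
      using that \<open>\<forall>x\<in>topspace X. h' (f x) = g x\<close> hf unfolding surj[symmetric] by auto
  qed
  ultimately show ?thesis using hf by blast
qed

section \<open>Unitization\<close>

lemma ring_part_simps [simp]:
  "ring_part 0 = 0" "ring_part 1 = 0"
  "ring_part (x + y) = ring_part x + ring_part y"
  "ring_part (x - y) = ring_part x - ring_part y"
  "ring_part (- x) = - ring_part x"
  by (simp_all add: zero_unitization_def one_unitization_def plus_unitization_def
      minus_unitization_def uminus_unitization_def)

lemma scalar_part_simps [simp]:
  "scalar_part 0 = 0" "scalar_part 1 = 1"
  "scalar_part (x + y) = scalar_part x + scalar_part y"
  "scalar_part (x - y) = scalar_part x - scalar_part y"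
  "scalar_part (- x) = - scalar_part x"
  "scalar_part (x * y) = scalar_part x * scalar_part y"
  by (simp_all add: zero_unitization_def one_unitization_def plus_unitization_def
      minus_unitization_def uminus_unitization_def times_unitization_def)

lemma part_emb [simp]: "scalar_part (emb a) = 0" "ring_part (emb a) = a"
  by (simp_all add: emb_def)

lemma emb_ring_part: "scalar_part x = 0 \<Longrightarrow> emb (ring_part x) = x"
  by (cases x) (simp add: emb_def)

lemma emb_0 [simp]: "emb 0 = 0"
  by (simp add: emb_def zero_unitization_def)

text \<open>The scalar part is a ring homomorphism to the integers with kernel \<open>A\<close>. Hence membership of a
  power series in \<open>1 + tA[[t]]\<close> says that its image under this homomorphism is \<open>1\<close> (together with
  the constant term being exactly \<open>1\<close>), which makes closure under products and inverses formal.\<close>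

lemma mem_range_emb_iff: "x \<in> range emb \<longleftrightarrow> scalar_part x = 0"
  by (metis emb_ring_part imageE part_emb(1) rangeI)

lemma scalar_part_sum: "scalar_part (\<Sum>i\<in>F. f i) = (\<Sum>i\<in>F. scalar_part (f i))"
  by (induction F rule: infinite_finite_induct) auto

lemma ring_part_sum: "ring_part (\<Sum>i\<in>F. f i) = (\<Sum>i\<in>F. ring_part (f i))"
  by (induction F rule: infinite_finite_induct) auto

text \<open>Subrings in the non-unital sense. The two instances that matter are the whole ring \<open>A\<close> and the
  ideal \<open>I\<close>.\<close>

definition subrng :: "'a::comm_ring set \<Rightarrow> bool" where
  "subrng J \<longleftrightarrow> 0 \<in> J \<and> (\<forall>x\<in>J. \<forall>y\<in>J. x - y \<in> J \<and> x * y \<in> J)"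

lemma subrng_UNIV: "subrng UNIV"
  by (simp add: subrng_def)

lemma subrng_uminus: "subrng J \<Longrightarrow> x \<in> J \<Longrightarrow> - x \<in> J"
  by (metis diff_0 subrng_def)

lemma subrng_add: "subrng J \<Longrightarrow> x \<in> J \<Longrightarrow> y \<in> J \<Longrightarrow> x + y \<in> J"
  by (metis diff_minus_eq_add subrng_def subrng_uminus)

lemma subrng_diff: "subrng J \<Longrightarrow> x \<in> J \<Longrightarrow> y \<in> J \<Longrightarrow> x - y \<in> J"
  by (simp add: subrng_def)

lemma subrng_sum: "subrng J \<Longrightarrow> (\<And>i. i \<in> F \<Longrightarrow> f i \<in> J) \<Longrightarrow> (\<Sum>i\<in>F. f i) \<in> J"
  by (induction F rule: infinite_finite_induct) (auto intro: subrng_add simp: subrng_def)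

lemma subrng_nmul: "subrng J \<Longrightarrow> x \<in> J \<Longrightarrow> nmul n x \<in> J"
  unfolding nmul_def by (rule subrng_sum)

lemma subrng_zmul: "subrng J \<Longrightarrow> x \<in> J \<Longrightarrow> zmul k x \<in> J"
  unfolding zmul_def by (intro subrng_diff subrng_nmul)

lemma subrng_npow: "subrng J \<Longrightarrow> x \<in> J \<Longrightarrow> npow x n \<in> J"
  by (induction x n rule: npow.induct) (auto simp: subrng_def)

lemma ring_part_mult_mem:
  "subrng J \<Longrightarrow> ring_part x \<in> J \<Longrightarrow> ring_part y \<in> J \<Longrightarrow> ring_part (x * y) \<in> J"
  by (auto simp: times_unitization_def subrng_def intro!: subrng_add subrng_zmul)

section \<open>The group $1 + tJ[[t]]$\<close>

text \<open>This is the group $\hat U(J)$, realised inside $\hat U(A)$. Since the constant term is \<open>1\<close>, its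
  ring part is \<open>0\<close>, so the condition may be imposed at \<open>n = 0\<close> as well.\<close>

definition Uhat_on :: "'a::comm_ring set \<Rightarrow> 'a unitization fps set" where
  "Uhat_on J = {P \<in> carrier Uhat. \<forall>n. ring_part (fps_nth P n) \<in> J}"

lemma carrier_Uhat_iff:
  "P \<in> carrier Uhat \<longleftrightarrow>
     fps_nth P 0 = 1 \<and> (\<forall>n. scalar_part (fps_nth P n) = (if n = 0 then 1 else 0))"
  by (auto simp: Uhat_def mem_range_emb_iff)

lemma Uhat_simps [simp]: "mult Uhat = (*)" "one Uhat = 1"
  by (simp_all add: Uhat_def)

lemma Uhat_on_UNIV [simp]: "Uhat_on UNIV = carrier Uhat"
  by (simp add: Uhat_on_def)

lemma Uhat_nth_eqI:
  assumes "P \<in> carrier Uhat" "Q \<in> carrier Uhat"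
    and "n > 0 \<Longrightarrow> ring_part (fps_nth P n) = ring_part (fps_nth Q n)"
  shows "fps_nth P n = fps_nth Q n"
  using assms by (cases "n = 0") (auto simp: carrier_Uhat_iff intro!: unitization.expand)

lemma scalar_part_fps_mult_nth:
  assumes "P \<in> carrier Uhat"
  shows "scalar_part (fps_nth (P * Q) n) = scalar_part (fps_nth Q n)"
proof -
  have "scalar_part (fps_nth (P * Q) n)
      = (\<Sum>i=0..n. if i = 0 then scalar_part (fps_nth Q n) else 0)"
    unfolding fps_mult_nth scalar_part_sum
    by (rule sum.cong) (use assms in \<open>auto simp: carrier_Uhat_iff\<close>)
  then show ?thesis by simp
qed

lemma Uhat_mult_closed:
  assumes "P \<in> carrier Uhat" "Q \<in> carrier Uhat"
  shows "P * Q \<in> carrier Uhat"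
  using assms unfolding carrier_Uhat_iff[of "P * Q"]
  by (simp add: scalar_part_fps_mult_nth) (simp add: carrier_Uhat_iff)

lemma Uhat_ex_inverse:
  assumes "P \<in> carrier Uhat"
  obtains Q where "Q \<in> carrier Uhat" "P * Q = 1"
proof -
  define Q where "Q = fps_right_inverse P 1"
  have PQ: "P * Q = 1"
    unfolding Q_def using assms by (intro fps_right_inverse) (simp add: carrier_Uhat_iff)
  have "fps_nth (P * Q) 0 = 1" by (simp add: PQ)
  then have "fps_nth Q 0 = 1" using assms by (simp add: carrier_Uhat_iff)
  moreover have "scalar_part (fps_nth Q n) = (if n = 0 then 1 else 0)" for n
    using scalar_part_fps_mult_nth[OF assms, of Q n] by (cases "n = 0") (simp_all add: PQ)
  ultimately have "Q \<in> carrier Uhat" by (simp add: carrier_Uhat_iff)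
  then show ?thesis using PQ that by blast
qed

lemma one_mem_Uhat: "1 \<in> carrier Uhat"
  by (simp add: carrier_Uhat_iff)

lemma comm_group_Uhat: "comm_group (Uhat :: 'a::comm_ring unitization fps monoid)"
proof (rule comm_groupI)
  show "\<exists>y\<in>carrier Uhat. y \<otimes>\<^bsub>Uhat\<^esub> x = \<one>\<^bsub>Uhat\<^esub>"
    if "x \<in> carrier Uhat" for x :: "'a unitization fps"
    using Uhat_ex_inverse[OF that] by (metis Uhat_simps mult.commute)
qed (auto simp: Uhat_mult_closed one_mem_Uhat mult_ac)

interpretation Uhat: comm_group "Uhat :: 'a::comm_ring unitization fps monoid"
  by (rule comm_group_Uhat)

lemma Uhat_inv_mult:
  assumes "P \<in> carrier Uhat"
  shows "inv\<^bsub>Uhat\<^esub> P * P = 1" "P * inv\<^bsub>Uhat\<^esub> P = 1"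
  using Uhat.l_inv[OF assms] Uhat.r_inv[OF assms] by simp_all

text \<open>The coefficients of the inverse satisfy a recursion whose terms are products of coefficients of
  \<open>P\<close> with earlier coefficients of the inverse, so they stay in \<open>J\<close>.\<close>

lemma subgroup_Uhat_on:
  assumes J: "subrng J"
  shows "subgroup (Uhat_on J) Uhat"
proof (rule Uhat.subgroupI)
  show "Uhat_on J \<subseteq> carrier Uhat" by (auto simp: Uhat_on_def)
  have "1 \<in> Uhat_on J"
    using J one_mem_Uhat by (auto simp: Uhat_on_def subrng_def)
  then show "Uhat_on J \<noteq> {}" by blast
  fix P assume P: "P \<in> Uhat_on J"
  then have Pc: "P \<in> carrier Uhat" and PJ: "ring_part (fps_nth P n) \<in> J" for n
    by (auto simp: Uhat_on_def)
  define Q where "Q = inv\<^bsub>Uhat\<^esub> P"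
  have Q: "Q \<in> carrier Uhat" "P * Q = 1"
    using Uhat_inv_mult[OF Pc] Pc by (auto simp: Q_def)
  have "ring_part (fps_nth Q n) \<in> J" for n
  proof (induction n rule: less_induct)
    case (less n)
    have "fps_nth (1 :: 'a unitization fps) n
        = (\<Sum>i=0..n. fps_nth P i * fps_nth Q (n - i))"
      unfolding Q(2)[symmetric] fps_mult_nth ..
    also have "\<dots> = fps_nth Q n + (\<Sum>i=1..n. fps_nth P i * fps_nth Q (n - i))"
      using Pc by (simp add: sum.atLeast_Suc_atMost carrier_Uhat_iff)
    finally have "ring_part (fps_nth (1 :: 'a unitization fps) n)
        = ring_part (fps_nth Q n) + (\<Sum>i=1..n. ring_part (fps_nth P i * fps_nth Q (n - i)))"
      by (simp only: ring_part_simps ring_part_sum)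
    then have "ring_part (fps_nth Q n)
        = - (\<Sum>i=1..n. ring_part (fps_nth P i * fps_nth Q (n - i)))"
      by (cases "n = 0") (simp_all add: eq_neg_iff_add_eq_0)
    moreover have "(\<Sum>i=1..n. ring_part (fps_nth P i * fps_nth Q (n - i))) \<in> J"
      by (intro subrng_sum J ring_part_mult_mem PJ less) auto
    ultimately show ?case using J by (simp add: subrng_uminus)
  qed
  then show "inv\<^bsub>Uhat\<^esub> P \<in> Uhat_on J" using Q by (simp add: Uhat_on_def Q_def)
  fix Q' assume "Q' \<in> Uhat_on J"
  then show "P \<otimes>\<^bsub>Uhat\<^esub> Q' \<in> Uhat_on J"
    using P J by (auto simp: Uhat_on_def Uhat_mult_closed fps_mult_nth ring_part_sum
        intro!: subrng_sum ring_part_mult_mem)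
qed

lemma fps_agree_mult:
  fixes P P' Q Q' :: "'a::comm_ring_1 fps"
  assumes "fps_agree n P P'" "fps_agree n Q Q'"
  shows "fps_agree n (P * Q) (P' * Q')"
  unfolding agree_def
proof (intro ballI impI)
  fix k assume "k \<le> n"
  then show "fps_nth (P * Q) k = fps_nth (P' * Q') k"
    unfolding fps_mult_nth using assms by (intro sum.cong) (auto simp: agree_def)
qed

text \<open>From \<open>P\<inverse> = (P\<inverse> Q\<inverse>) Q\<close> and \<open>Q\<inverse> = (P\<inverse> Q\<inverse>) P\<close>, so the claim reduces to multiplication by a common
  factor.\<close>

lemma fps_agree_inv_Uhat:
  assumes "P \<in> carrier Uhat" "Q \<in> carrier Uhat" "fps_agree n P Q"
  shows "fps_agree n (inv\<^bsub>Uhat\<^esub> P) (inv\<^bsub>Uhat\<^esub> Q)"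
proof -
  let ?p = "inv\<^bsub>Uhat\<^esub> P" and ?q = "inv\<^bsub>Uhat\<^esub> Q"
  have "fps_agree n (?p * ?q * Q) (?p * ?q * P)"
    using assms(3) by (intro fps_agree_mult) (auto intro: agree_sym)
  moreover have "?p * ?q * Q = ?p"
    by (simp add: mult.assoc Uhat_inv_mult assms)
  moreover have "?p * ?q * P = ?q"
    by (simp add: mult.commute[of ?p] mult.assoc Uhat_inv_mult assms)
  ultimately show ?thesis by simp
qed

section \<open>Product expansions of power series\<close>

definition factor :: "nat \<Rightarrow> 'a::comm_ring \<Rightarrow> 'a unitization fps" where
  "factor n a = 1 - fps_const (emb a) * fps_X ^ n"

definition partial_prod :: "(nat \<Rightarrow> 'a::comm_ring) \<Rightarrow> nat \<Rightarrow> 'a unitization fps" where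
  "partial_prod a N = (\<Prod>n=1..N. factor n (a n))"

text \<open>The infinite product \<open>\<Prod>\<^sub>n (1 - a\<^sub>n t\<^sup>n)\<close>. Factors beyond the \<open>k\<close>-th do not change the coefficient
  of \<open>t\<^sup>k\<close>, so it may be read off the \<open>k\<close>-th partial product. The entry \<open>a\<^sub>0\<close> does not occur.\<close>

definition Wprod :: "(nat \<Rightarrow> 'a::comm_ring) \<Rightarrow> 'a unitization fps" where
  "Wprod a = Abs_fps (\<lambda>k. fps_nth (partial_prod a k) k)"

lemma partial_prod_0 [simp]: "partial_prod a 0 = 1"
  by (simp add: partial_prod_def)

lemma partial_prod_Suc: "partial_prod a (Suc N) = partial_prod a N * factor (Suc N) (a (Suc N))"
  by (simp add: partial_prod_def)

lemma factor_mem_Uhat: "n > 0 \<Longrightarrow> factor n a \<in> carrier Uhat"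
  by (auto simp: carrier_Uhat_iff factor_def)

lemma factor_mem_Uhat_on:
  "subrng J \<Longrightarrow> a \<in> J \<Longrightarrow> n > 0 \<Longrightarrow> factor n a \<in> Uhat_on J"
  by (auto simp: Uhat_on_def factor_mem_Uhat)
     (auto simp: factor_def subrng_def subrng_uminus)

lemma partial_prod_mem:
  assumes H: "subgroup H Uhat" and "\<And>n. n > 0 \<Longrightarrow> factor n (a n) \<in> H"
  shows "partial_prod a N \<in> H"
proof (induction N)
  case 0
  show ?case using subgroup.one_closed[OF H] by simp
next
  case (Suc N)
  then show ?case
    using subgroup.m_closed[OF H, of "partial_prod a N" "factor (Suc N) (a (Suc N))"] assms(2)
    by (simp add: partial_prod_Suc)
qed

lemma partial_prod_mem_Uhat: "partial_prod a N \<in> carrier Uhat"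
  by (rule partial_prod_mem[OF Uhat.subgroup_self factor_mem_Uhat])

lemma partial_prod_Suc_nth:
  "fps_nth (partial_prod a (Suc N)) k =
     (if k \<le> N then fps_nth (partial_prod a N) k
      else fps_nth (partial_prod a N) k - emb (a (Suc N)) * fps_nth (partial_prod a N) (k - Suc N))"
proof -
  have "partial_prod a (Suc N)
      = partial_prod a N - fps_const (emb (a (Suc N))) * (fps_X ^ Suc N * partial_prod a N)"
    by (simp add: partial_prod_Suc factor_def algebra_simps)
  then show ?thesis by (simp add: fps_X_power_mult_nth del: power_Suc)
qed

lemma partial_prod_nth_self:
  "fps_nth (partial_prod a (Suc N)) (Suc N) = fps_nth (partial_prod a N) (Suc N) - emb (a (Suc N))"
  using partial_prod_mem_Uhat[of a N] by (simp add: partial_prod_Suc_nth carrier_Uhat_iff)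

lemma fps_agree_Wprod_partial_prod: "fps_agree n (Wprod a) (partial_prod a n)"
proof -
  have "fps_nth (partial_prod a (k + d)) k = fps_nth (partial_prod a k) k" for k d
    by (induction d) (simp_all add: partial_prod_Suc_nth)
  then show ?thesis
    unfolding agree_def Wprod_def by (metis fps_nth_Abs_fps le_Suc_ex)
qed

lemma Wprod_nth_Suc:
  "fps_nth (Wprod a) (Suc n) = fps_nth (partial_prod a n) (Suc n) - emb (a (Suc n))"
  by (simp add: Wprod_def partial_prod_nth_self)

lemma partial_prod_cong: "agree {0<..} n a b \<Longrightarrow> partial_prod a n = partial_prod b n"
  unfolding partial_prod_def by (intro prod.cong) (auto simp: agree_def)

text \<open>The \<open>n\<close>-th coefficient of the product is \<open>-a\<^sub>n\<close> plus a polynomial in the earlier entries, so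
  the coefficients and the entries determine each other level by level.\<close>

lemma fps_agree_Wprod_iff: "fps_agree n (Wprod a) (Wprod b) \<longleftrightarrow> agree {0<..} n a b"
proof
  assume "agree {0<..} n a b"
  then have "partial_prod a n = partial_prod b n" by (rule partial_prod_cong)
  then show "fps_agree n (Wprod a) (Wprod b)"
    using fps_agree_Wprod_partial_prod[of n a] fps_agree_Wprod_partial_prod[of n b]
    by (metis agree_sym agree_trans)
next
  assume ab: "fps_agree n (Wprod a) (Wprod b)"
  have "k \<le> n \<Longrightarrow> agree {0<..} k a b" for k
  proof (induction k)
    case (Suc k)
    then have k: "agree {0<..} k a b" by simp
    have "fps_nth (Wprod a) (Suc k) = fps_nth (Wprod b) (Suc k)"
      using ab Suc.prems by (simp add: agree_def)
    then have "emb (a (Suc k)) = emb (b (Suc k))"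
      using partial_prod_cong[OF k] by (simp add: Wprod_nth_Suc)
    then have "a (Suc k) = b (Suc k)" by (metis part_emb(2))
    then show ?case using k by (auto simp: agree_def le_Suc_eq)
  qed (simp add: agree_def)
  then show "agree {0<..} n a b" by simp
qed

lemma Wprod_eq_iff: "Wprod a = Wprod b \<longleftrightarrow> (\<forall>n>0. a n = b n)"
proof
  assume "Wprod a = Wprod b"
  then have "agree {0<..} n a b" for n using fps_agree_Wprod_iff[of n a b] by simp
  then show "\<forall>n>0. a n = b n" by (auto simp: agree_def)
next
  assume "\<forall>n>0. a n = b n"
  then have "agree {0<..} n a b" for n by (simp add: agree_def)
  then show "Wprod a = Wprod b" by (intro fps_agree_all_imp_eq) (simp add: fps_agree_Wprod_iff)
qed

lemma Wprod_mem:
  assumes J: "subrng J" and a: "\<And>n. n > 0 \<Longrightarrow> a n \<in> J"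
  shows "Wprod a \<in> Uhat_on J"
proof -
  have "partial_prod a n \<in> Uhat_on J" for n
    using a by (intro partial_prod_mem subgroup_Uhat_on factor_mem_Uhat_on J)
  then show ?thesis
    unfolding Uhat_on_def carrier_Uhat_iff by (auto simp: Wprod_def)
qed

lemma Wprod_mem_Uhat: "Wprod a \<in> carrier Uhat"
  using Wprod_mem[OF subrng_UNIV] by simp

lemma equivp_fps_agree: "equivp (fps_agree n :: 'a::comm_ring_1 fps \<Rightarrow> _)"
  using agreement_fps unfolding agreement_topology_def by blast

text \<open>Every element of $\hat U(J)$ is such a product: having matched the coefficients up to \<open>n\<close>, the
  coefficient of \<open>t\<^sup>n\<^sup>+\<^sup>1\<close> is corrected by adding to \<open>a\<^sub>n\<^sub>+\<^sub>1\<close> the difference \<open>c\<close> of the two coefficients,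
  which lies in \<open>J\<close> and disturbs no lower coefficient.\<close>

lemma Uhat_on_eq_range_Wprod:
  assumes J: "subrng J" and P: "P \<in> Uhat_on J"
  obtains a where "\<And>n. a n \<in> J" "Wprod a = P"
proof -
  have Pc: "P \<in> carrier Uhat" using P by (simp add: Uhat_on_def)
  have "\<exists>a. (\<forall>k. a k \<in> J) \<and> fps_agree n (Wprod a) P" for n
  proof (induction n)
    case 0
    have "fps_agree 0 (Wprod (\<lambda>_. 0)) P"
      using Pc by (simp add: agree_def Wprod_def carrier_Uhat_iff)
    then show ?case using J by (intro exI[of _ "\<lambda>_. 0"]) (simp add: subrng_def)
  next
    case (Suc n)
    then obtain a where a: "\<And>k. a k \<in> J" "fps_agree n (Wprod a) P" by blast
    define c where "c = ring_part (fps_nth (Wprod a) (Suc n)) - ring_part (fps_nth P (Suc n))"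
    define b where "b = a(Suc n := a (Suc n) + c)"
    have ab: "agree {0<..} n b a" by (auto simp: b_def agree_def)
    have "Wprod a \<in> Uhat_on J" using J a(1) by (intro Wprod_mem)
    then have "c \<in> J" using P J by (auto simp: c_def Uhat_on_def intro!: subrng_diff)
    then have "b k \<in> J" for k using a(1) J by (auto simp: b_def intro: subrng_add)
    moreover have "fps_agree (Suc n) (Wprod b) P"
      unfolding agree_def
    proof (intro ballI impI)
      fix k assume "k \<le> Suc n"
      then consider "k \<le> n" | "k = Suc n" by linarith
      then show "fps_nth (Wprod b) k = fps_nth P k"
      proof cases
        case 1
        have "fps_agree n (Wprod b) P"
          using ab a(2) by (metis agree_trans fps_agree_Wprod_iff)
        then show ?thesis using 1 by (simp add: agree_def)
      next
        case 2
        have "ring_part (fps_nth (Wprod b) (Suc n)) = ring_part (fps_nth P (Suc n))"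
          using partial_prod_cong[OF ab] by (simp add: Wprod_nth_Suc c_def b_def)
        then show ?thesis using 2 by (simp add: Uhat_nth_eqI[OF Wprod_mem_Uhat Pc])
      qed
    qed
    ultimately show ?case by blast
  qed
  then have "\<exists>a. (\<forall>k. a k \<in> J) \<and> (\<forall>n. fps_agree n (Wprod a) P)"
    by (intro agreement_glue[of fps_agree Wprod "{0<..}"] equivp_fps_agree fps_agree_Wprod_iff)
       (auto intro: agree_mono)
  then show ?thesis using that fps_agree_all_imp_eq by metis
qed

section \<open>The logarithmic derivative\<close>

definition logder :: "'a::comm_ring unitization fps \<Rightarrow> 'a unitization fps" where
  "logder P = - (fps_X * fps_deriv P * inv\<^bsub>Uhat\<^esub> P)"

lemma mu_eq: "mu P = (\<lambda>n\<in>{0<..}. ring_part (fps_nth (logder P) n))"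
  by (simp add: mu_def logder_def)

text \<open>Computing \<open>-tP'/P\<close> by this criterion avoids writing down the inverse of \<open>P\<close>.\<close>

lemma logder_unique:
  assumes P: "P \<in> carrier Uhat" and D: "D * P = - (fps_X * fps_deriv P)"
  shows "logder P = D"
proof -
  have "logder P = - (fps_X * fps_deriv P) * inv\<^bsub>Uhat\<^esub> P" by (simp add: logder_def)
  also have "\<dots> = D * (P * inv\<^bsub>Uhat\<^esub> P)" by (simp only: D[symmetric] mult.assoc)
  finally show ?thesis by (simp add: Uhat_inv_mult[OF P])
qed

lemma logder_times:
  assumes "P \<in> carrier Uhat"
  shows "logder P * P = - (fps_X * fps_deriv P)"
  unfolding logder_def by (simp add: mult.assoc Uhat_inv_mult[OF assms])

lemma logder_mult:
  assumes P: "P \<in> carrier Uhat" and Q: "Q \<in> carrier Uhat"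
  shows "logder (P * Q) = logder P + logder Q"
proof (rule logder_unique)
  show "P * Q \<in> carrier Uhat" using P Q by (rule Uhat_mult_closed)
  have "(logder P + logder Q) * (P * Q) = (logder P * P) * Q + P * (logder Q * Q)"
    by (simp add: algebra_simps)
  also have "\<dots> = - (fps_X * fps_deriv P) * Q + P * - (fps_X * fps_deriv Q)"
    by (simp only: logder_times[OF P] logder_times[OF Q])
  finally show "(logder P + logder Q) * (P * Q) = - (fps_X * fps_deriv (P * Q))"
    by (simp add: algebra_simps)
qed

text \<open>The restriction supplies the default value of \<open>mu\<close> at index \<open>0\<close>, where it is not additive.\<close>

lemma mu_mult:
  assumes "P \<in> carrier Uhat" "Q \<in> carrier Uhat"
  shows "mu (P * Q) n = (\<lambda>n\<in>{0<..}. mu P n + mu Q n) n"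
  by (simp add: mu_eq logder_mult[OF assms])

lemma mu_one:
  assumes "n > 0"
  shows "mu (1 :: 'a::comm_ring unitization fps) n = 0"
proof -
  have "logder (1 :: 'a unitization fps) = 0" by (rule logder_unique[OF one_mem_Uhat]) simp
  then show ?thesis using assms by (simp add: mu_eq)
qed

lemma mu_inv:
  assumes "P \<in> carrier Uhat" "n > 0"
  shows "mu (inv\<^bsub>Uhat\<^esub> P) n = - mu P n"
proof -
  have "mu P n + mu (inv\<^bsub>Uhat\<^esub> P) n = 0"
    using mu_mult[OF assms(1) Uhat.inv_closed[OF assms(1)], of n] assms
    by (simp add: Uhat_inv_mult mu_one)
  then show ?thesis by (simp add: eq_neg_iff_add_eq_0 add.commute)
qed

lemma fps_X_deriv_nth:
  "fps_nth (fps_X * fps_deriv P) n = of_nat n * fps_nth P n" for P :: "'a::comm_ring_1 fps"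
  by (cases n) simp_all

lemma agree_mu:
  assumes P: "P \<in> carrier Uhat" and Q: "Q \<in> carrier Uhat" and "fps_agree n P Q"
  shows "agree {0<..} n (mu P) (mu Q)"
proof -
  have "fps_agree n (fps_X * fps_deriv P) (fps_X * fps_deriv Q)"
    using assms(3) by (simp add: agree_def fps_X_deriv_nth)
  then have "fps_agree n (fps_X * fps_deriv P * inv\<^bsub>Uhat\<^esub> P) (fps_X * fps_deriv Q * inv\<^bsub>Uhat\<^esub> Q)"
    by (rule fps_agree_mult[OF _ fps_agree_inv_Uhat[OF assms]])
  then show ?thesis
    by (simp add: agree_def mu_eq logder_def)
qed

lemma ring_part_of_nat_emb: "ring_part (of_nat n * emb x) = nmul n x"
  by (induction n) (simp_all add: distrib_right)

text \<open>The geometric series \<open>n a t\<^sup>n / (1 - a t\<^sup>n) = \<Sum>\<^sub>i n a\<^sup>i t\<^sup>n\<^sup>i\<close> (over \<open>i \<ge> 1\<close>),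
  verified by multiplying the series \<open>D\<close> on the right with \<open>1 - a t\<^sup>n\<close>.\<close>

lemma mu_factor:
  assumes n: "n > 0" and m: "m > 0"
  shows "mu (factor n a) m = (if n dvd m then nmul n (npow a (m div n)) else 0)"
proof -
  define D where "D = Abs_fps (\<lambda>k. if k > 0 \<and> n dvd k then of_nat n * emb (npow a (k div n)) else 0)"
  have Dk: "fps_nth D k = (if k > 0 \<and> n dvd k then of_nat n * emb (npow a (k div n)) else 0)" for k
    by (simp add: D_def)
  have "fps_nth (D * factor n a) k = fps_nth (- (fps_X * fps_deriv (factor n a))) k" for k
  proof -
    have "D * factor n a = D - fps_const (emb a) * (fps_X ^ n * D)"
      by (simp add: factor_def algebra_simps)
    then have L: "fps_nth (D * factor n a) k
        = fps_nth D k - emb a * (if k < n then 0 else fps_nth D (k - n))"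
      by (simp add: fps_X_power_mult_nth)
    have R: "fps_nth (- (fps_X * fps_deriv (factor n a))) k
        = (if k = n then of_nat n * emb a else 0)"
      using n by (simp add: fps_X_deriv_nth factor_def)
    consider "k < n" | "k = n" | "n < k" "\<not> n dvd k" | "n < k" "n dvd k" by linarith
    then show ?thesis
    proof cases
      case 1
      then have "fps_nth D k = 0" using nat_dvd_not_less by (auto simp: Dk)
      then show ?thesis using 1 L R by simp
    next
      case 2
      then show ?thesis using n unfolding L R Dk by simp
    next
      case 3
      then have "\<not> n dvd k - n" using dvd_add[of n "k - n" n] by auto
      then show ?thesis using 3 unfolding L R Dk by simp
    next
      case 4
      then obtain j where "k = n * j" by blast
      with 4 obtain i where k: "k = n * Suc (Suc i)"
        by (metis One_nat_def less_irrefl mult.right_neutral mult_0_right not_less0 old.nat.exhaust)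
      then have "k - n = n * Suc i" by simp
      then have "fps_nth D (k - n) = of_nat n * emb (npow a (Suc i))"
        using n by (simp add: Dk del: mult_Suc_right)
      moreover have "fps_nth D k = of_nat n * emb (npow a (Suc (Suc i)))"
        using n k by (simp add: Dk del: mult_Suc_right npow.simps)
      ultimately show ?thesis
        using 4 unfolding L R by (simp add: emb_mult algebra_simps)
    qed
  qed
  then have "logder (factor n a) = D"
    by (intro logder_unique factor_mem_Uhat n fps_ext)
  then show ?thesis using m by (simp add: mu_eq Dk ring_part_of_nat_emb)
qed

lemma mu_Wprod:
  assumes m: "m > 0"
  shows "mu (Wprod a) m = (\<Sum>n | n dvd m. nmul n (npow (a n) (m div n)))"
proof -
  have "mu (partial_prod a N) m = (\<Sum>n=1..N. mu (factor n (a n)) m)" for N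
    using m
    by (induction N) (simp_all add: mu_one partial_prod_Suc mu_mult partial_prod_mem_Uhat factor_mem_Uhat)
  moreover have "mu (Wprod a) m = mu (partial_prod a m) m"
    using agree_mu[OF Wprod_mem_Uhat partial_prod_mem_Uhat fps_agree_Wprod_partial_prod, of m a] m
    by (simp add: agree_def)
  ultimately have "mu (Wprod a) m
      = (\<Sum>n=1..m. if n dvd m then nmul n (npow (a n) (m div n)) else 0)"
    using m by (simp add: mu_factor)
  also have "\<dots> = (\<Sum>n | n dvd m. nmul n (npow (a n) (m div n)))"
    using m dvd_imp_le dvd_pos_nat by (intro sum.mono_neutral_cong_right) (auto simp: Suc_le_eq)
  finally show ?thesis .
qed

text \<open>The map \<open>\<mu>\<close> followed by the projection from sequences indexed by all positive integers to those
  indexed by \<open>S\<close>; it computes ghost components of the Witt vector that a power series represents.\<close>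

definition ghost :: "nat set \<Rightarrow> 'a::comm_ring unitization fps \<Rightarrow> nat \<Rightarrow> 'a" where
  "ghost S P = restrict (mu P) S"

text \<open>The bridge between the two halves of the theorem: \<open>\<Psi>\<^sub>S\<close> is \<open>\<mu>\<close> in the coordinates given by the
  product expansion.\<close>

lemma ghost_Wprod:
  assumes "S \<subseteq> {0<..}"
  shows "ghost S (Wprod a) = Psi S a"
  unfolding ghost_def Psi_def using assms by (intro restrict_ext) (auto simp: mu_Wprod)

lemma ghost_mult:
  assumes "S \<subseteq> {0<..}" "P \<in> carrier Uhat" "Q \<in> carrier Uhat"
  shows "ghost S (P * Q) = (\<lambda>n\<in>S. ghost S P n + ghost S Q n)"
  unfolding ghost_def using assms(1) by (intro restrict_ext) (auto simp: mu_mult[OF assms(2,3)])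

lemma ghost_one: "S \<subseteq> {0<..} \<Longrightarrow> ghost S 1 = (\<lambda>n\<in>S. 0)"
  unfolding ghost_def by (intro restrict_ext mu_one) auto

lemma ghost_inv:
  assumes "S \<subseteq> {0<..}" "P \<in> carrier Uhat"
  shows "ghost S (inv\<^bsub>Uhat\<^esub> P) = (\<lambda>n\<in>S. - ghost S P n)"
  unfolding ghost_def using assms(1) by (intro restrict_ext) (auto simp: mu_inv[OF assms(2)])

lemma agree_ghost:
  assumes "S \<subseteq> {0<..}" "P \<in> carrier Uhat" "Q \<in> carrier Uhat" "fps_agree n P Q"
  shows "agree S n (ghost S P) (ghost S Q)"
  using agree_mu[OF assms(2-4)] assms(1) by (auto simp: agree_def ghost_def)

lemma Vmap_teich_eq_ghost:
  assumes S: "S \<subseteq> {0<..}" and n: "n \<in> S"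
  shows "Vmap S n (teich (div_set S n) a) = ghost S (factor n a)"
proof -
  have "m div n \<in> div_set S n" if "m \<in> S" "n dvd m" for m
    using that S by (auto simp: div_set_def elim!: dvdE)
  moreover have "n > 0" "\<And>m. m \<in> S \<Longrightarrow> m > 0" using S n by auto
  ultimately show ?thesis
    unfolding Vmap_def ghost_def by (intro restrict_ext) (auto simp: mu_factor teich_def)
qed

section \<open>The group $X_S$ as an image of power series\<close>

lemma pow_group_simps [simp]:
  "carrier (pow_group S J) = S \<rightarrow>\<^sub>E J"
  "mult (pow_group S J) = (\<lambda>x y. \<lambda>n\<in>S. x n + y n)"
  "one (pow_group S J) = (\<lambda>n\<in>S. 0)"
  by (simp_all add: pow_group_def)

lemma comm_group_pow_group:
  assumes J: "subrng J"
  shows "comm_group (pow_group S J)"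
proof (rule comm_groupI)
  fix x assume x: "x \<in> carrier (pow_group S J)"
  show "\<exists>y\<in>carrier (pow_group S J). y \<otimes>\<^bsub>pow_group S J\<^esub> x = \<one>\<^bsub>pow_group S J\<^esub>"
    using x J by (intro bexI[of _ "\<lambda>n\<in>S. - x n"]) (auto intro: subrng_uminus)
  show "\<one>\<^bsub>pow_group S J\<^esub> \<otimes>\<^bsub>pow_group S J\<^esub> x = x"
    using x by (auto simp: fun_eq_iff PiE_def extensional_def)
qed (use J in \<open>auto intro: subrng_add simp: add_ac subrng_def fun_eq_iff\<close>)

lemma inv_pow_group:
  assumes "subrng J" "x \<in> S \<rightarrow>\<^sub>E J"
  shows "inv\<^bsub>pow_group S J\<^esub> x = (\<lambda>n\<in>S. - x n)"
proof -
  interpret comm_group "pow_group S J" using assms(1) by (rule comm_group_pow_group)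
  show ?thesis
    using assms by (intro inv_equality) (auto intro: subrng_uminus)
qed

lemma truncation_set_pos: "truncation_set S \<Longrightarrow> S \<subseteq> {0<..}"
  by (simp add: truncation_set_def)

lemma Psi_cong:
  assumes "truncation_set S" "\<And>n. n \<in> S \<Longrightarrow> a n = b n"
  shows "Psi S a = Psi S b"
  unfolding Psi_def
proof (intro restrict_ext sum.cong refl)
  fix m d assume "m \<in> S" "d \<in> {n. n dvd m}"
  then have "d \<in> S" using assms(1) by (auto simp: truncation_set_def)
  then show "nmul d (npow (a d) (m div d)) = nmul d (npow (b d) (m div d))" using assms(2) by simp
qed

text \<open>The \<open>m\<close>-th component of \<open>\<Psi>\<^sub>S(a)\<close> is \<open>m a\<^sub>m\<close> plus an expression in the \<open>a\<^sub>d\<close> for proper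
  divisors \<open>d\<close> of \<open>m\<close>, and \<open>m\<close> may be cancelled.\<close>

lemma agree_Psi_iff:
  fixes a b :: "nat \<Rightarrow> 'a::comm_ring"
  assumes S: "truncation_set S" and tf: "no_torsion S (UNIV :: 'a set)"
  shows "agree S n (Psi S a) (Psi S b) \<longleftrightarrow> agree S n a b"
proof
  have dS: "d \<in> S" "d \<le> m" if "m \<in> S" "d dvd m" for d m
    using S that dvd_imp_le[of d m] by (auto simp: truncation_set_def)
  assume "agree S n a b"
  then show "agree S n (Psi S a) (Psi S b)"
    unfolding agree_def Psi_def using dS by (auto intro!: sum.cong) (metis order_trans)
next
  assume L: "agree S n (Psi S a) (Psi S b)"
  have "m \<in> S \<Longrightarrow> m \<le> n \<Longrightarrow> a m = b m" for m
  proof (induction m rule: less_induct)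
    case (less m)
    have m: "m > 0" using S less.prems by (auto simp: truncation_set_def)
    define D where "D = {d. d dvd m} - {m}"
    have split: "Psi S c m = nmul m (c m) + (\<Sum>d\<in>D. nmul d (npow (c d) (m div d)))"
      for c :: "nat \<Rightarrow> 'a"
      using m less.prems unfolding Psi_def D_def
      by (simp add: sum.remove[of "{d. d dvd m}" m])
    have "a d = b d" if "d \<in> D" for d
    proof -
      have "d dvd m" "d \<noteq> m" using that by (auto simp: D_def)
      then have "d < m" using dvd_imp_le[of d m] m by simp
      moreover have "d \<in> S" using \<open>d dvd m\<close> less.prems S by (auto simp: truncation_set_def)
      ultimately show ?thesis using less by simp
    qed
    then have "nmul m (a m) = nmul m (b m)"
      using L less.prems split[of a] split[of b] by (simp add: agree_def)
    then have "nmul m (a m - b m) = 0" by (simp add: nmul_minus)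
    then have "a m - b m = 0" using tf less.prems unfolding no_torsion_def by blast
    then show ?case by simp
  qed
  then show "agree S n a b" by (simp add: agree_def)
qed

lemma Psi_eq_iff:
  fixes a b :: "nat \<Rightarrow> 'a::comm_ring"
  assumes S: "truncation_set S" and tf: "no_torsion S (UNIV :: 'a set)"
  shows "Psi S a = Psi S b \<longleftrightarrow> (\<forall>n\<in>S. a n = b n)"
proof
  assume "Psi S a = Psi S b"
  then have "agree S n a b" for n using agree_Psi_iff[OF S tf, of n a b] by simp
  then show "\<forall>n\<in>S. a n = b n" by (auto simp: agree_def)
qed (use Psi_cong[OF S] in blast)

lemma closed_subgroup_generated_eqI:
  assumes "subgroup K G" "closedin T K" "B \<subseteq> K"
    and "\<And>H. subgroup H G \<Longrightarrow> closedin T H \<Longrightarrow> B \<subseteq> H \<Longrightarrow> K \<subseteq> H"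
  shows "closed_subgroup_generated G T B = K"
  unfolding closed_subgroup_generated_def using assms by (intro hull_unique) auto

text \<open>That the values of \<open>\<Psi>\<^sub>S\<close> on \<open>J\<^sup>S\<close> are closed under addition is the existence of the universal Witt
  vector addition polynomials. Here it comes for free, since these values are the image of the group
  $\hat U(J)$ under a homomorphism. They form a closed set because, in the absence of torsion,
  approximate preimages under \<open>\<Psi>\<^sub>S\<close> fit together, and they lie in every closed subgroup containing
  the generators because a product is the limit of its partial products.\<close>

theorem XS_eq_ghost_image:
  fixes J :: "'a::comm_ring set"
  assumes S: "truncation_set S" and tf: "no_torsion S (UNIV :: 'a set)" and J: "subrng J"
  shows "XS S J = ghost S ` Uhat_on J"
  unfolding XS_def
proof (rule closed_subgroup_generated_eqI)
  have Sp: "S \<subseteq> {0<..}" using S by (rule truncation_set_pos)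
  have J0: "0 \<in> J" using J by (simp add: subrng_def)
  interpret pow: comm_group "pow_group S J" using J by (rule comm_group_pow_group)
  note sub = subgroup_Uhat_on[OF J]
  have cU: "P \<in> carrier Uhat" if "P \<in> Uhat_on J" for P using that by (simp add: Uhat_on_def)
  have img: "\<exists>a. (\<forall>n. a n \<in> J) \<and> ghost S P = Psi S a" if "P \<in> Uhat_on J" for P
    using Uhat_on_eq_range_Wprod[OF J that] ghost_Wprod[OF Sp] by metis
  have PsiJ: "Psi S a \<in> S \<rightarrow>\<^sub>E J" if "\<And>n. a n \<in> J" for a
    unfolding Psi_def using J that by (auto intro!: subrng_sum subrng_nmul subrng_npow)
  have ghJ: "ghost S P \<in> S \<rightarrow>\<^sub>E J" if "P \<in> Uhat_on J" for P
    using img[OF that] PsiJ by metis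
  show "subgroup (ghost S ` Uhat_on J) (pow_group S J)"
  proof (rule pow.subgroupI)
    show "ghost S ` Uhat_on J \<subseteq> carrier (pow_group S J)" using ghJ by auto
    show "ghost S ` Uhat_on J \<noteq> {}" using subgroup.one_closed[OF sub] by blast
  next
    fix x assume "x \<in> ghost S ` Uhat_on J"
    then obtain P where P: "P \<in> Uhat_on J" "x = ghost S P" by blast
    have "inv\<^bsub>pow_group S J\<^esub> x = ghost S (inv\<^bsub>Uhat\<^esub> P)"
      using inv_pow_group[OF J ghJ] ghost_inv[OF Sp cU] P by simp
    then show "inv\<^bsub>pow_group S J\<^esub> x \<in> ghost S ` Uhat_on J"
      using subgroup.m_inv_closed[OF sub P(1)] by blast
    fix y assume "y \<in> ghost S ` Uhat_on J"
    then obtain Q where Q: "Q \<in> Uhat_on J" "y = ghost S Q" by blast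
    have "x \<otimes>\<^bsub>pow_group S J\<^esub> y = ghost S (P \<otimes>\<^bsub>Uhat\<^esub> Q)"
      using ghost_mult[OF Sp cU cU] P Q by simp
    then show "x \<otimes>\<^bsub>pow_group S J\<^esub> y \<in> ghost S ` Uhat_on J"
      using subgroup.m_closed[OF sub P(1) Q(1)] by blast
  qed
  show "closedin (pow_topology S J) (ghost S ` Uhat_on J)"
    unfolding closedin_agreement_iff[OF agreement_pow_topology]
  proof (intro conjI ballI impI)
    show "ghost S ` Uhat_on J \<subseteq> topspace (pow_topology S J)" using ghJ by auto
    fix x assume x: "x \<in> topspace (pow_topology S J)"
      and "\<forall>n. \<exists>y\<in>ghost S ` Uhat_on J. agree S n x y"
    then have "\<exists>a. (\<forall>k. a k \<in> J) \<and> agree S n (Psi S a) x" for n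
      using img agree_sym by (metis imageE)
    moreover have "equivp (agree S n :: (nat \<Rightarrow> 'a) \<Rightarrow> _)" for n
      using agreement_pow_topology[of S J] unfolding agreement_topology_def by blast
    ultimately obtain a where a: "\<And>k. a k \<in> J" "\<And>n. agree S n (Psi S a) x"
      using agreement_glue[of "agree S" "Psi S" S J x] agree_Psi_iff[OF S tf] agree_mono
      by (metis (no_types, lifting))
    have "x = Psi S a"
      using a(2) x by (intro agree_all_imp_eq[of S x]) (auto intro: agree_sym simp: Psi_def PiE_def)
    moreover have "Psi S a = ghost S (Wprod a)" by (rule ghost_Wprod[OF Sp, symmetric])
    ultimately show "x \<in> ghost S ` Uhat_on J" using Wprod_mem[OF J] a(1) by blast
  qed
  show "{Vmap S n (teich (div_set S n) a) |n a. n \<in> S \<and> a \<in> J} \<subseteq> ghost S ` Uhat_on J"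
  proof clarify
    fix n a assume "n \<in> S" "a \<in> J"
    then show "Vmap S n (teich (div_set S n) a) \<in> ghost S ` Uhat_on J"
      using Vmap_teich_eq_ghost[OF Sp \<open>n \<in> S\<close>, of a] factor_mem_Uhat_on[OF J \<open>a \<in> J\<close>, of n] Sp
      by (metis greaterThan_iff image_eqI subsetD)
  qed
  fix H
  assume H: "subgroup H (pow_group S J)" and cl: "closedin (pow_topology S J) H"
    and gen: "{Vmap S n (teich (div_set S n) a) |n a. n \<in> S \<and> a \<in> J} \<subseteq> H"
  show "ghost S ` Uhat_on J \<subseteq> H"
  proof
    fix x assume "x \<in> ghost S ` Uhat_on J"
    then obtain a0 where a0: "\<And>n. a0 n \<in> J" "x = Psi S a0" using img by blast
    define a where "a n = (if n \<in> S then a0 n else 0)" for n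
    have aJ: "a n \<in> J" for n using a0 J0 by (simp add: a_def)
    have x: "x = ghost S (Wprod a)"
      using a0(2) Psi_cong[OF S, of a a0] by (simp add: ghost_Wprod[OF Sp] a_def)
    have fac: "ghost S (factor n (a n)) \<in> H" if "n > 0" for n
    proof (cases "n \<in> S")
      case True
      then have "Vmap S n (teich (div_set S n) (a n)) \<in> H" using gen aJ[of n] by blast
      then show ?thesis by (simp only: Vmap_teich_eq_ghost[OF Sp True])
    next
      case False
      then have "factor n (a n) = 1" by (simp add: factor_def a_def)
      then show ?thesis using subgroup.one_closed[OF H] by (simp add: ghost_one[OF Sp])
    qed
    have "ghost S (partial_prod a N) \<in> H" for N
    proof (induction N)
      case 0
      show ?case
        using subgroup.one_closed[OF H] by (simp only: partial_prod_0 ghost_one[OF Sp] pow_group_simps)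
    next
      case (Suc N)
      have eq: "ghost S (partial_prod a (Suc N))
          = ghost S (partial_prod a N) \<otimes>\<^bsub>pow_group S J\<^esub> ghost S (factor (Suc N) (a (Suc N)))"
        by (simp add: partial_prod_Suc ghost_mult[OF Sp partial_prod_mem_Uhat factor_mem_Uhat])
      show ?case unfolding eq by (rule subgroup.m_closed[OF H Suc fac]) simp
    qed
    moreover have "agree S n x (ghost S (partial_prod a n))" for n
      unfolding x by (intro agree_ghost Sp Wprod_mem_Uhat partial_prod_mem_Uhat
          fps_agree_Wprod_partial_prod)
    moreover have "x \<in> S \<rightarrow>\<^sub>E J" using PsiJ a0 by simp
    ultimately show "x \<in> H"
      using cl unfolding closedin_agreement_iff[OF agreement_pow_topology] topspace_pow_topology
      by blast
  qed
qed

lemma XS_eq_Psi_image: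
  fixes J :: "'a::comm_ring set"
  assumes S: "truncation_set S" and tf: "no_torsion S (UNIV :: 'a set)" and J: "subrng J"
  shows "XS S J = {Psi S a | a. \<forall>n. a n \<in> J}"
proof -
  have "Uhat_on J = {Wprod a | a. \<forall>n. a n \<in> J}"
  proof (intro equalityI subsetI)
    fix P assume P: "P \<in> Uhat_on J"
    obtain a where "\<And>n. a n \<in> J" "Wprod a = P"
      using Uhat_on_eq_range_Wprod[OF J P] by blast
    then show "P \<in> {Wprod a | a. \<forall>n. a n \<in> J}" by blast
  qed (use Wprod_mem[OF J] in blast)
  then have "ghost S ` Uhat_on J = {ghost S (Wprod a) | a. \<forall>n. a n \<in> J}" by auto
  then show ?thesis
    by (simp only: XS_eq_ghost_image[OF assms] ghost_Wprod[OF truncation_set_pos[OF S]])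
qed

section \<open>Functoriality in a torsion-free presentation\<close>

lemma map_unitization_parts [simp]:
  "scalar_part (map_unitization f x) = scalar_part x"
  "ring_part (map_unitization f x) = f (ring_part x)"
  by (cases x; simp)+

lemma Uhat_map_nth [simp]: "fps_nth (Uhat_map f P) n = map_unitization f (fps_nth P n)"
  by (simp add: Uhat_map_def)

lemma Uhat_eqI:
  assumes "P \<in> carrier Uhat" "Q \<in> carrier Uhat"
    and "\<And>n. n > 0 \<Longrightarrow> ring_part (fps_nth P n) = ring_part (fps_nth Q n)"
  shows "P = Q"
  using assms by (intro fps_ext Uhat_nth_eqI)

lemma rcos_eq_iff:
  assumes "group G" "subgroup N G" "x \<in> carrier G" "y \<in> carrier G"
  shows "N #>\<^bsub>G\<^esub> x = N #>\<^bsub>G\<^esub> y \<longleftrightarrow> x \<otimes>\<^bsub>G\<^esub> inv\<^bsub>G\<^esub> y \<in> N"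
proof -
  interpret group G by fact
  have "x \<otimes>\<^bsub>G\<^esub> inv\<^bsub>G\<^esub> y \<in> N \<longleftrightarrow> x \<in> N #>\<^bsub>G\<^esub> y"
    using subgroup.rcos_module[OF assms(2,1) assms(4,3)] by simp
  then show ?thesis
    using repr_independence[OF _ assms(4,2)] rcos_self[OF assms(3,2)] by metis
qed

locale torsion_free_presentation =
  fixes S :: "nat set" and I :: "'a::comm_ring set" and \<pi> :: "'a \<Rightarrow> 'r::comm_ring"
  assumes trunc: "truncation_set S"
    and pres: "presentation I \<pi>"
    and torsion_free: "no_torsion S (UNIV :: 'a set)"
begin

lemma S_pos: "S \<subseteq> {0<..}"
  using trunc by (rule truncation_set_pos)

lemma pi_add: "\<pi> (x + y) = \<pi> x + \<pi> y"
  and pi_mult: "\<pi> (x * y) = \<pi> x * \<pi> y"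
  and mem_I_iff: "x \<in> I \<longleftrightarrow> \<pi> x = 0"
  and surj_pi: "surj \<pi>"
  using pres by (auto simp: presentation_def)

lemma pi_0 [simp]: "\<pi> 0 = 0"
  using pi_add[of 0 0] by simp

lemma pi_uminus: "\<pi> (- x) = - \<pi> x"
  using pi_add[of x "- x"] by (simp add: eq_neg_iff_add_eq_0 add.commute)

lemma pi_diff: "\<pi> (x - y) = \<pi> x - \<pi> y"
  using pi_add[of x "- y"] by (simp add: pi_uminus)

lemma pi_sum: "\<pi> (\<Sum>i\<in>F. f i) = (\<Sum>i\<in>F. \<pi> (f i))"
  by (induction F rule: infinite_finite_induct) (auto simp: pi_add)

lemma pi_zmul: "\<pi> (zmul k x) = zmul k (\<pi> x)"
  by (simp add: zmul_def nmul_def pi_diff pi_sum)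

lemma subrng_I: "subrng I"
  by (simp add: subrng_def mem_I_iff pi_diff pi_mult)

lemma map_unitization_mult:
  "map_unitization \<pi> (x * y) = map_unitization \<pi> x * map_unitization \<pi> y"
  by (rule unitization.expand) (simp add: times_unitization_def pi_add pi_mult pi_zmul)

lemma map_unitization_sum:
  "map_unitization \<pi> (\<Sum>i\<in>F. f i) = (\<Sum>i\<in>F. map_unitization \<pi> (f i))"
  by (rule unitization.expand) (simp add: scalar_part_sum ring_part_sum pi_sum)

lemma Uhat_map_mult: "Uhat_map \<pi> (P * Q) = Uhat_map \<pi> P * Uhat_map \<pi> Q"
  by (rule fps_ext) (simp add: fps_mult_nth map_unitization_sum map_unitization_mult)

lemma Uhat_map_mem: "P \<in> carrier Uhat \<Longrightarrow> Uhat_map \<pi> P \<in> carrier Uhat"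
  by (auto simp: carrier_Uhat_iff intro!: unitization.expand)

lemma Uhat_map_one: "Uhat_map \<pi> 1 = 1"
  by (rule Uhat_eqI) (auto intro!: Uhat_map_mem one_mem_Uhat)

lemma group_hom_Uhat_map: "group_hom Uhat Uhat (Uhat_map \<pi>)"
  by unfold_locales (auto simp: hom_def Uhat_map_mem Uhat_map_mult)

lemma Uhat_map_factor: "n > 0 \<Longrightarrow> Uhat_map \<pi> (factor n a) = factor n (\<pi> a)"
  by (rule Uhat_eqI) (auto simp: factor_def pi_uminus intro!: Uhat_map_mem factor_mem_Uhat[unfolded factor_def])

lemma Uhat_map_partial_prod: "Uhat_map \<pi> (partial_prod a N) = partial_prod (\<lambda>n. \<pi> (a n)) N"
  by (induction N) (simp_all add: Uhat_map_one partial_prod_Suc Uhat_map_mult Uhat_map_factor)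

lemma Uhat_map_Wprod: "Uhat_map \<pi> (Wprod a) = Wprod (\<lambda>n. \<pi> (a n))"
  by (rule fps_ext) (simp add: Wprod_def flip: Uhat_map_partial_prod)

lemma Uhat_map_eq_one_iff:
  assumes P: "P \<in> carrier Uhat"
  shows "Uhat_map \<pi> P = 1 \<longleftrightarrow> P \<in> Uhat_on I"
proof
  assume "Uhat_map \<pi> P = 1"
  then have "ring_part (fps_nth (Uhat_map \<pi> P) n) = 0" for n by simp
  then show "P \<in> Uhat_on I" using P by (simp add: Uhat_on_def mem_I_iff)
next
  assume "P \<in> Uhat_on I"
  then show "Uhat_map \<pi> P = 1"
    using P by (intro Uhat_eqI Uhat_map_mem one_mem_Uhat) (auto simp: Uhat_on_def mem_I_iff)
qed

section \<open>The fibres of the maps to $E_S$\<close>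

lemma XS_subgroup:
  fixes J :: "'a set"
  assumes J: "subrng J"
  shows "subgroup (XS S J) (pow_group S UNIV)"
proof -
  interpret pow: comm_group "pow_group S (UNIV :: 'a set)"
    by (rule comm_group_pow_group[OF subrng_UNIV])
  have "ghost S P \<in> S \<rightarrow>\<^sub>E UNIV" for P :: "'a unitization fps" by (simp add: ghost_def)
  then have "group_hom Uhat (pow_group S UNIV) (ghost S :: 'a unitization fps \<Rightarrow> _)"
    by unfold_locales (auto simp: hom_def ghost_mult[OF S_pos])
  then show ?thesis
    unfolding XS_eq_ghost_image[OF trunc torsion_free J]
    by (rule group_hom.subgroup_img_is_subgroup) (rule subgroup_Uhat_on[OF J])
qed

lemma comm_group_XS_group: "comm_group (XS_group S (UNIV :: 'a set))"
proof -
  interpret pow: comm_group "pow_group S (UNIV :: 'a set)"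
    by (rule comm_group_pow_group[OF subrng_UNIV])
  have "group (XS_group S (UNIV :: 'a set))"
    unfolding XS_group_def
    by (rule subgroup.subgroup_is_group[OF XS_subgroup[OF subrng_UNIV] pow.is_group])
  then show ?thesis
    by (rule group.group_comm_groupI) (auto simp: XS_group_def add.commute)
qed

lemma XS_group_simps [simp]:
  "carrier (XS_group S (UNIV :: 'a set)) = XS S UNIV"
  "mult (XS_group S (UNIV :: 'a set)) = (\<lambda>x y. \<lambda>n\<in>S. x n + y n)"
  by (simp_all add: XS_group_def)

lemma XS_UNIV_eq: "XS S (UNIV :: 'a set) = ghost S ` carrier Uhat"
  using XS_eq_ghost_image[OF trunc torsion_free subrng_UNIV] by simp

lemma XS_I_normal: "XS S I \<lhd> XS_group S UNIV"
proof -
  interpret X: comm_group "XS_group S (UNIV :: 'a set)" by (rule comm_group_XS_group)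
  interpret pow: comm_group "pow_group S (UNIV :: 'a set)"
    by (rule comm_group_pow_group[OF subrng_UNIV])
  have "XS S I \<subseteq> XS S UNIV"
    unfolding XS_UNIV_eq XS_eq_ghost_image[OF trunc torsion_free subrng_I]
    by (auto simp: Uhat_on_def)
  then have "subgroup (XS S I) (XS_group S UNIV)"
    unfolding XS_group_def
    by (intro pow.subgroup_incl XS_subgroup subrng_I subrng_UNIV)
  then show ?thesis by (simp add: X.normal_iff_subgroup)
qed

lemma group_hom_ghost: "group_hom Uhat (XS_group S UNIV) (ghost S :: 'a unitization fps \<Rightarrow> _)"
proof -
  interpret X: comm_group "XS_group S (UNIV :: 'a set)" by (rule comm_group_XS_group)
  show ?thesis
    by unfold_locales (auto simp: hom_def ghost_mult[OF S_pos] XS_UNIV_eq)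
qed

lemma ghost_mem_XS: "P \<in> carrier Uhat \<Longrightarrow> ghost S P \<in> XS S (UNIV :: 'a set)"
  by (simp add: XS_UNIV_eq)

lemma E_proj_hom: "(\<lambda>P. E_proj S I (ghost S P)) \<in> hom Uhat (E_group S I)"
  using hom_compose[OF group_hom.homh[OF group_hom_ghost] normal.r_coset_hom_Mod[OF XS_I_normal]]
  unfolding E_proj_def[abs_def] E_group_def comp_def .

lemma E_proj_image: "E_proj S I ` XS S UNIV = carrier (E_group S I)"
  by (auto simp: E_proj_def E_group_def FactGroup_def RCOSETS_def)

lemma E_proj_ghost_eq_iff:
  assumes P: "P \<in> carrier Uhat" and Q: "Q \<in> carrier Uhat"
  shows "E_proj S I (ghost S P) = E_proj S I (ghost S Q)
    \<longleftrightarrow> ghost S (P * inv\<^bsub>Uhat\<^esub> Q) \<in> XS S I"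
proof -
  interpret gh: group_hom Uhat "XS_group S UNIV" "ghost S :: 'a unitization fps \<Rightarrow> _"
    by (rule group_hom_ghost)
  have "ghost S (P \<otimes>\<^bsub>Uhat\<^esub> inv\<^bsub>Uhat\<^esub> Q)
      = ghost S P \<otimes>\<^bsub>XS_group S UNIV\<^esub> inv\<^bsub>XS_group S UNIV\<^esub> ghost S Q"
    by (simp only: gh.hom_mult gh.hom_inv P Q Uhat.inv_closed)
  then show ?thesis
    unfolding E_proj_def
    using rcos_eq_iff[OF gh.H.is_group normal_imp_subgroup[OF XS_I_normal], of "ghost S P" "ghost S Q"]
      ghost_mem_XS[OF P] ghost_mem_XS[OF Q]
    by simp
qed

text \<open>By injectivity of \<open>\<Psi>\<^sub>S\<close>, a value \<open>\<Psi>\<^sub>S(a)\<close> in \<open>X\<^sub>S(I) = \<Psi>\<^sub>S(I\<^sup>S)\<close> forces the entries of \<open>a\<close> on \<open>S\<close> to lie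
  in \<open>I\<close>.\<close>

lemma ghost_Wprod_mem_XS_iff:
  "ghost S (Wprod a) \<in> XS S I \<longleftrightarrow> (\<forall>n\<in>S. \<pi> (a n) = 0)"
proof
  assume "ghost S (Wprod a) \<in> XS S I"
  then obtain c where "\<And>n. c n \<in> I" "Psi S a = Psi S c"
    unfolding XS_eq_Psi_image[OF trunc torsion_free subrng_I] ghost_Wprod[OF S_pos] by blast
  then show "\<forall>n\<in>S. \<pi> (a n) = 0"
    by (simp add: Psi_eq_iff[OF trunc torsion_free] mem_I_iff)
next
  assume a: "\<forall>n\<in>S. \<pi> (a n) = 0"
  define c where "c n = (if n \<in> S then a n else 0)" for n
  have "Psi S a = Psi S c" by (rule Psi_cong[OF trunc]) (simp add: c_def)
  moreover have "\<forall>n. c n \<in> I" using a by (simp add: c_def mem_I_iff)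
  ultimately show "ghost S (Wprod a) \<in> XS S I"
    unfolding XS_eq_Psi_image[OF trunc torsion_free subrng_I] ghost_Wprod[OF S_pos] by blast
qed

text \<open>The fibres of \<open>q \<circ> \<Psi>\<^sub>S\<close> are those of \<open>\<pi>\<^sup>S\<close>. If \<open>a\<close> and \<open>b\<close> agree modulo \<open>I\<close>, the quotient of their products
  lies in the kernel of $\hat U(\pi)$, that is in $\hat U(I)$. Conversely, let \<open>\<Psi>\<^sub>S(a) = \<Psi>\<^sub>S(c) + \<Psi>\<^sub>S(b)\<close> with
  \<open>c\<close> in \<open>I\<close>, and expand the product of the series of \<open>c\<close> and \<open>b\<close> with entries \<open>d\<close>. Over \<open>R\<close> the series of \<open>c\<close>
  becomes \<open>1\<close>, so \<open>d\<close> and \<open>b\<close> agree modulo \<open>I\<close>, while injectivity of \<open>\<Psi>\<^sub>S\<close> gives \<open>d = a\<close> on \<open>S\<close>.\<close>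

lemma E_proj_Psi_eq_iff:
  "E_proj S I (Psi S a) = E_proj S I (Psi S b) \<longleftrightarrow> (\<forall>n\<in>S. \<pi> (a n) = \<pi> (b n))"
proof
  interpret um: group_hom Uhat Uhat "Uhat_map \<pi>" by (rule group_hom_Uhat_map)
  assume ab: "\<forall>n\<in>S. \<pi> (a n) = \<pi> (b n)"
  \<comment> \<open>Only the entries on \<open>S\<close> are known to agree, so the others are made equal; \<open>\<Psi>\<^sub>S\<close> does not see them.\<close>
  define b' where "b' n = (if n \<in> S then b n else a n)" for n
  have "Uhat_map \<pi> (Wprod a) = Uhat_map \<pi> (Wprod b')"
    unfolding Uhat_map_Wprod Wprod_eq_iff using ab by (simp add: b'_def)
  moreover have "Uhat_map \<pi> (Wprod a \<otimes>\<^bsub>Uhat\<^esub> inv\<^bsub>Uhat\<^esub> Wprod b')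
      = Uhat_map \<pi> (Wprod a) \<otimes>\<^bsub>Uhat\<^esub> inv\<^bsub>Uhat\<^esub> Uhat_map \<pi> (Wprod b')"
    by (simp only: um.hom_mult um.hom_inv Wprod_mem_Uhat Uhat.inv_closed)
  ultimately have "Uhat_map \<pi> (Wprod a * inv\<^bsub>Uhat\<^esub> Wprod b') = 1"
    by (simp add: Uhat_inv_mult Uhat_map_mem Wprod_mem_Uhat)
  then have "Wprod a * inv\<^bsub>Uhat\<^esub> Wprod b' \<in> Uhat_on I"
    by (simp add: Uhat_map_eq_one_iff[symmetric] Uhat_mult_closed Wprod_mem_Uhat)
  then have "ghost S (Wprod a * inv\<^bsub>Uhat\<^esub> Wprod b') \<in> XS S I"
    unfolding XS_eq_ghost_image[OF trunc torsion_free subrng_I] by blast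
  then have "E_proj S I (Psi S a) = E_proj S I (Psi S b')"
    by (simp add: E_proj_ghost_eq_iff[symmetric] Wprod_mem_Uhat ghost_Wprod[OF S_pos])
  moreover have "Psi S b' = Psi S b" by (rule Psi_cong[OF trunc]) (simp add: b'_def)
  ultimately show "E_proj S I (Psi S a) = E_proj S I (Psi S b)" by simp
next
  interpret gh: group_hom Uhat "XS_group S UNIV" "ghost S :: 'a unitization fps \<Rightarrow> _"
    by (rule group_hom_ghost)
  assume "E_proj S I (Psi S a) = E_proj S I (Psi S b)"
  then have "ghost S (Wprod a * inv\<^bsub>Uhat\<^esub> Wprod b) \<in> XS S I"
    by (simp add: E_proj_ghost_eq_iff[symmetric] Wprod_mem_Uhat ghost_Wprod[OF S_pos])
  then obtain c where c: "\<And>n. c n \<in> I" "ghost S (Wprod a * inv\<^bsub>Uhat\<^esub> Wprod b) = ghost S (Wprod c)"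
    unfolding XS_eq_Psi_image[OF trunc torsion_free subrng_I] ghost_Wprod[OF S_pos] by blast
  have "Wprod c * Wprod b \<in> Uhat_on UNIV" by (simp add: Uhat_mult_closed Wprod_mem_Uhat)
  then obtain d where d: "Wprod d = Wprod c * Wprod b"
    using Uhat_on_eq_range_Wprod[OF subrng_UNIV] by metis
  have "ghost S (Wprod d) = ghost S (Wprod a * inv\<^bsub>Uhat\<^esub> Wprod b * Wprod b)"
    by (simp add: d c(2) ghost_mult[OF S_pos] Wprod_mem_Uhat Uhat_mult_closed)
  also have "Wprod a * inv\<^bsub>Uhat\<^esub> Wprod b * Wprod b = Wprod a"
    by (simp add: mult.assoc Uhat_inv_mult Wprod_mem_Uhat)
  finally have da: "\<forall>n\<in>S. d n = a n"
    by (simp add: ghost_Wprod[OF S_pos] Psi_eq_iff[OF trunc torsion_free])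
  have "Uhat_map \<pi> (Wprod c) = 1"
    using Wprod_mem[OF subrng_I, of c] c(1) by (simp add: Uhat_map_eq_one_iff Wprod_mem_Uhat)
  then have "Wprod (\<lambda>n. \<pi> (d n)) = Wprod (\<lambda>n. \<pi> (b n))"
    using arg_cong[OF d, of "Uhat_map \<pi>"] by (simp add: Uhat_map_mult Uhat_map_Wprod)
  then show "\<forall>n\<in>S. \<pi> (a n) = \<pi> (b n)"
    using da S_pos by (metis Wprod_eq_iff greaterThan_iff subsetD)
qed

section \<open>The group $H_S$ and cosets modulo it\<close>

lemma subgroup_ghost_kernel: "subgroup {P \<in> carrier Uhat. ghost S P \<in> XS S I} Uhat"
proof -
  interpret gh: group_hom Uhat "XS_group S UNIV" "ghost S :: 'a unitization fps \<Rightarrow> _"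
    by (rule group_hom_ghost)
  note sub = normal_imp_subgroup[OF XS_I_normal]
  show ?thesis
  proof (rule Uhat.subgroupI)
    show "{P \<in> carrier Uhat. ghost S P \<in> XS S I} \<noteq> {}"
      using gh.hom_one subgroup.one_closed[OF sub] Uhat.one_closed by auto
  next
    fix P assume "P \<in> {P \<in> carrier Uhat. ghost S P \<in> XS S I}"
    then show "inv\<^bsub>Uhat\<^esub> P \<in> {P \<in> carrier Uhat. ghost S P \<in> XS S I}"
      using subgroup.m_inv_closed[OF sub, of "ghost S P"] by (simp del: XS_group_simps)
  next
    fix P Q assume "P \<in> {P \<in> carrier Uhat. ghost S P \<in> XS S I}"
      "Q \<in> {P \<in> carrier Uhat. ghost S P \<in> XS S I}"
    then show "P \<otimes>\<^bsub>Uhat\<^esub> Q \<in> {P \<in> carrier Uhat. ghost S P \<in> XS S I}"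
      using subgroup.m_closed[OF sub, of "ghost S P" "ghost S Q"] gh.hom_mult[of P Q]
      by (auto simp del: XS_group_simps intro: Uhat_mult_closed)
  qed auto
qed

text \<open>Over \<open>A\<close>, which has no \<open>S\<close>-torsion, the vanishing of entries on \<open>S\<close> modulo \<open>I\<close> is detected by a
  homomorphism. This makes the set of products over \<open>R\<close> with entries vanishing on \<open>S\<close> the image of a
  subgroup, hence a subgroup, although \<open>R\<close> may have torsion.\<close>

lemma Wprod_vanishing_on_S_eq_image:
  "{Wprod b | b. \<forall>n\<in>S. b n = 0} = Uhat_map \<pi> ` {P \<in> carrier Uhat. ghost S P \<in> XS S I}"
proof (intro equalityI subsetI)
  obtain s where s: "\<And>y. \<pi> (s y) = y" using surj_pi by (metis surj_f_inv_f)
  fix Q :: "'r unitization fps"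
  assume "Q \<in> {Wprod b | b. \<forall>n\<in>S. b n = 0}"
  then obtain b where b: "Q = Wprod b" "\<forall>n\<in>S. b n = 0" by blast
  have "Uhat_map \<pi> (Wprod (\<lambda>n. s (b n))) = Q" by (simp add: Uhat_map_Wprod s b(1))
  moreover have "Wprod (\<lambda>n. s (b n)) \<in> {P \<in> carrier Uhat. ghost S P \<in> XS S I}"
    using b(2) by (simp add: Wprod_mem_Uhat ghost_Wprod_mem_XS_iff s)
  ultimately show "Q \<in> Uhat_map \<pi> ` {P \<in> carrier Uhat. ghost S P \<in> XS S I}" by blast
next
  fix Q assume "Q \<in> Uhat_map \<pi> ` {P \<in> carrier Uhat. ghost S P \<in> XS S I}"
  then obtain P where P: "P \<in> carrier Uhat" "ghost S P \<in> XS S I" "Q = Uhat_map \<pi> P" by blast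
  obtain a where "P = Wprod a" using Uhat_on_eq_range_Wprod[OF subrng_UNIV] P(1)
    by (metis Uhat_on_UNIV)
  then show "Q \<in> {Wprod b | b. \<forall>n\<in>S. b n = 0}"
    using P by (auto simp: ghost_Wprod_mem_XS_iff Uhat_map_Wprod)
qed

lemma subgroup_Wprod_vanishing_on_S:
  "subgroup {Wprod b | b :: nat \<Rightarrow> 'r. \<forall>n\<in>S. b n = 0} Uhat"
  unfolding Wprod_vanishing_on_S_eq_image
  by (rule group_hom.subgroup_img_is_subgroup[OF group_hom_Uhat_map subgroup_ghost_kernel])

text \<open>The set on the right is closed since the entries up to \<open>n\<close> depend only on the coefficients up to
  \<open>n\<close>, and each of its elements is a limit of finite products of generators.\<close>

theorem HS_eq: "(HS S :: 'r unitization fps set) = {Wprod b | b. \<forall>n\<in>S. b n = 0}"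
  unfolding HS_def
proof (rule closed_subgroup_generated_eqI[OF subgroup_Wprod_vanishing_on_S])
  let ?K = "{Wprod b | b. \<forall>n\<in>S. b n = 0} :: 'r unitization fps set"
  show "closedin Uhat_topology ?K"
    unfolding closedin_agreement_iff[OF agreement_Uhat_topology]
  proof (intro conjI ballI impI)
    show "?K \<subseteq> topspace Uhat_topology" using Wprod_mem_Uhat by auto
    fix P :: "'r unitization fps"
    assume "P \<in> topspace Uhat_topology" and ex: "\<forall>n. \<exists>Q\<in>?K. fps_agree n P Q"
    then obtain b where b: "P = Wprod b" using Uhat_on_eq_range_Wprod[OF subrng_UNIV, of P]
      by (metis Uhat_on_UNIV topspace_Uhat_topology)
    have "b n = 0" if n: "n \<in> S" for n
    proof -
      obtain b' where b': "\<forall>n\<in>S. b' n = 0" "fps_agree n P (Wprod b')" using ex by blast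
      then have "agree {0<..} n b b'" by (simp add: b fps_agree_Wprod_iff)
      then show ?thesis using b'(1) n S_pos by (auto simp: agree_def)
    qed
    then show "P \<in> ?K" using b by blast
  qed
  show "{1 - fps_const (emb a) * fps_X ^ n |a n. 0 < n \<and> n \<notin> S} \<subseteq> ?K"
  proof
    fix Q :: "'r unitization fps"
    assume "Q \<in> {1 - fps_const (emb a) * fps_X ^ n |a n. 0 < n \<and> n \<notin> S}"
    then obtain n a where n: "0 < n" "n \<notin> S" and Q: "Q = factor n a"
      unfolding factor_def by blast
    obtain c where c: "\<pi> c = a" using surj_pi by (metis surj_def)
    have "ghost S (factor n c) = ghost S 1"
      unfolding ghost_def
    proof (rule restrict_ext)
      fix m assume m: "m \<in> S"
      then have "\<not> n dvd m" using trunc n by (auto simp: truncation_set_def)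
      then show "mu (factor n c) m = mu 1 m"
        using m S_pos n by (auto simp: mu_factor mu_one)
    qed
    then have "factor n c \<in> {P \<in> carrier Uhat. ghost S P \<in> XS S I}"
      using n subgroup.one_closed[OF subgroup_ghost_kernel] by (simp add: factor_mem_Uhat)
    then have "Uhat_map \<pi> (factor n c) \<in> ?K"
      unfolding Wprod_vanishing_on_S_eq_image by blast
    then show "Q \<in> ?K" by (simp only: Uhat_map_factor[OF n(1)] c Q)
  qed
  fix H :: "'r unitization fps set"
  assume H: "subgroup H Uhat" and cl: "closedin Uhat_topology H"
    and gen: "{1 - fps_const (emb a) * fps_X ^ n |a n. 0 < n \<and> n \<notin> S} \<subseteq> H"
  show "?K \<subseteq> H"
  proof clarify
    fix b :: "nat \<Rightarrow> 'r" assume b: "\<forall>n\<in>S. b n = 0"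
    have "factor n (b n) \<in> H" if "n > 0" for n
    proof (cases "n \<in> S")
      case True
      then have "factor n (b n) = 1" using b by (simp add: factor_def)
      then show ?thesis using subgroup.one_closed[OF H] by simp
    next
      case False
      then show ?thesis using gen that unfolding factor_def by blast
    qed
    then have "partial_prod b n \<in> H" for n by (intro partial_prod_mem H)
    then show "Wprod b \<in> H"
      using cl fps_agree_Wprod_partial_prod Wprod_mem_Uhat
      unfolding closedin_agreement_iff[OF agreement_Uhat_topology] topspace_Uhat_topology by blast
  qed
qed

lemma Uhat_map_mem_HS_iff:
  assumes "P \<in> carrier Uhat"
  shows "Uhat_map \<pi> P \<in> HS S \<longleftrightarrow> ghost S P \<in> XS S I"
proof -
  obtain a where a: "P = Wprod a"
    using Uhat_on_eq_range_Wprod[OF subrng_UNIV] assms by (metis Uhat_on_UNIV)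
  show ?thesis
    unfolding a ghost_Wprod_mem_XS_iff Uhat_map_Wprod HS_eq
    using S_pos by (auto simp: Wprod_eq_iff)
qed

lemma HS_normal: "(HS S :: 'r unitization fps set) \<lhd> Uhat"
  unfolding Uhat.normal_iff_subgroup HS_eq by (rule subgroup_Wprod_vanishing_on_S)

lemma UhatS_proj_hom: "(UhatS_proj S :: 'r unitization fps \<Rightarrow> _) \<in> hom Uhat (UhatS S)"
  using normal.r_coset_hom_Mod[OF HS_normal]
  unfolding UhatS_proj_def[abs_def] UhatS_def .

lemma UhatS_proj_image:
  "UhatS_proj S ` carrier Uhat = carrier (UhatS S :: 'r unitization fps set monoid)"
  by (auto simp: UhatS_proj_def UhatS_def FactGroup_def RCOSETS_def)

lemma UhatS_proj_Uhat_map_eq_iff: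
  assumes P: "P \<in> carrier Uhat" and Q: "Q \<in> carrier Uhat"
  shows "UhatS_proj S (Uhat_map \<pi> P) = UhatS_proj S (Uhat_map \<pi> Q)
    \<longleftrightarrow> E_proj S I (ghost S P) = E_proj S I (ghost S Q)"
proof -
  interpret um: group_hom Uhat Uhat "Uhat_map \<pi>" by (rule group_hom_Uhat_map)
  have "Uhat_map \<pi> (P \<otimes>\<^bsub>Uhat\<^esub> inv\<^bsub>Uhat\<^esub> Q)
      = Uhat_map \<pi> P \<otimes>\<^bsub>Uhat\<^esub> inv\<^bsub>Uhat\<^esub> Uhat_map \<pi> Q"
    by (simp only: um.hom_mult um.hom_inv P Q Uhat.inv_closed)
  then have "UhatS_proj S (Uhat_map \<pi> P) = UhatS_proj S (Uhat_map \<pi> Q)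
      \<longleftrightarrow> Uhat_map \<pi> (P \<otimes>\<^bsub>Uhat\<^esub> inv\<^bsub>Uhat\<^esub> Q) \<in> HS S"
    unfolding UhatS_proj_def
    using rcos_eq_iff[OF Uhat.is_group normal_imp_subgroup[OF HS_normal] Uhat_map_mem[OF P] Uhat_map_mem[OF Q]]
    by simp
  then show ?thesis
    using P Q by (simp add: Uhat_map_mem_HS_iff E_proj_ghost_eq_iff Uhat_mult_closed)
qed

text \<open>Applied to the trivial presentation, the description of \<open>H\<^sub>S\<close> over \<open>R\<close> becomes one over \<open>A\<close>.\<close>

lemma presented_by_itself: "torsion_free_presentation S {0} (\<lambda>x :: 'a. x)"
  using trunc torsion_free by unfold_locales (auto simp: presentation_def)

lemma ghost_HS:
  assumes "h \<in> HS S"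
  shows "h \<in> carrier Uhat" "ghost S h = (\<lambda>n\<in>S. 0 :: 'a)"
proof -
  obtain a :: "nat \<Rightarrow> 'a" where a: "h = Wprod a" "\<forall>n\<in>S. a n = 0"
    using assms unfolding torsion_free_presentation.HS_eq[OF presented_by_itself] by blast
  show "h \<in> carrier Uhat" by (simp add: a(1) Wprod_mem_Uhat)
  have "partial_prod (\<lambda>_. 0 :: 'a) N = 1" for N
    by (simp add: partial_prod_def factor_def)
  then have "Wprod (\<lambda>_. 0 :: 'a) = 1" by (intro fps_ext) (simp add: Wprod_def)
  moreover have "Psi S a = Psi S (\<lambda>_. 0)" using a(2) by (intro Psi_cong trunc) simp
  ultimately show "ghost S h = (\<lambda>n\<in>S. 0)"
    using ghost_one[OF S_pos, where 'a = 'a] by (simp only: a(1) ghost_Wprod[OF S_pos, symmetric])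
qed

text \<open>On a coset of \<open>H\<^sub>S(A)\<close> the map \<open>\<mu>\<close> is constant up to projection to \<open>S\<close>; this makes the maps
  induced on cosets evaluate as expected.\<close>

lemma mem_UhatS_proj:
  assumes P: "P \<in> carrier (Uhat :: 'a unitization fps monoid)" and Q: "Q \<in> UhatS_proj S P"
  shows "Q \<in> carrier Uhat" "ghost S Q = ghost S P"
proof -
  obtain h where h: "h \<in> HS S" "Q = h * P"
    using Q by (auto simp: UhatS_proj_def r_coset_def)
  show "Q \<in> carrier Uhat" using h P ghost_HS(1) by (simp add: Uhat_mult_closed)
  have "ghost S Q = (\<lambda>n\<in>S. ghost S h n + ghost S P n)"
    unfolding h(2) using ghost_HS(1)[OF h(1)] P by (rule ghost_mult[OF S_pos])
  moreover have "ghost S P \<in> extensional S" by (simp add: ghost_def)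
  then have "(\<lambda>n\<in>S. ghost S h n + ghost S P n) = ghost S P"
    by (intro extensionalityI[of _ S]) (simp_all add: ghost_HS(2)[OF h(1)])
  ultimately show "ghost S Q = ghost S P" by simp
qed

lemma self_mem_UhatS_proj:
  assumes "P \<in> carrier (Uhat :: 'a unitization fps monoid)"
  shows "P \<in> UhatS_proj S P"
  unfolding UhatS_proj_def
  using Uhat.rcos_self[OF assms normal_imp_subgroup[OF torsion_free_presentation.HS_normal[OF presented_by_itself]]] .

lemma UhatS_map_proj:
  assumes P: "P \<in> carrier Uhat"
  shows "UhatS_map S \<pi> (UhatS_proj S P) = UhatS_proj S (Uhat_map \<pi> P)"
  unfolding UhatS_map_def induced_def
proof (rule the_elem_image_unique)
  show "UhatS_proj S P \<noteq> {}" using self_mem_UhatS_proj[OF P] by blast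
  show "UhatS_proj S (Uhat_map \<pi> Q) = UhatS_proj S (Uhat_map \<pi> P)" if "Q \<in> UhatS_proj S P" for Q
    using mem_UhatS_proj[OF P that] P by (simp add: UhatS_proj_Uhat_map_eq_iff)
qed

lemma muS_proj:
  assumes P: "P \<in> carrier (Uhat :: 'a unitization fps monoid)"
  shows "muS S (UhatS_proj S P) = ghost S P"
  unfolding muS_def induced_def ghost_def[symmetric]
proof (rule the_elem_image_unique)
  show "UhatS_proj S P \<noteq> {}" using self_mem_UhatS_proj[OF P] by blast
  show "ghost S Q = ghost S P" if "Q \<in> UhatS_proj S P" for Q
    using mem_UhatS_proj[OF P that] by simp
qed

section \<open>Quotient maps and the two homeomorphisms\<close>

lemma agreement_XS_topology: "agreement_topology (XS_topology S (UNIV :: 'a set)) (agree S)"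
  unfolding XS_topology_def by (intro agreement_subtopology agreement_pow_topology)

lemma topspace_XS_topology [simp]: "topspace (XS_topology S (UNIV :: 'a set)) = XS S UNIV"
  unfolding XS_topology_def XS_UNIV_eq by (auto simp: ghost_def)

lemma quotient_map_E_proj: "quotient_map (XS_topology S UNIV) (E_topology S I) (E_proj S I)"
  unfolding E_topology_def by (rule quotient_map_quotient_topology)

text \<open>A section of \<open>\<Psi>\<^sub>S\<close>, extended by \<open>0\<close> outside \<open>S\<close> so that it also feeds the product
  expansion, whose entries are indexed by all positive integers.\<close>

lemma ex_Psi_section:
  obtains A :: "(nat \<Rightarrow> 'a) \<Rightarrow> nat \<Rightarrow> 'a"
  where "\<And>x. x \<in> XS S UNIV \<Longrightarrow> Psi S (A x) = x"
    "\<And>x y n. x \<in> XS S UNIV \<Longrightarrow> y \<in> XS S UNIV \<Longrightarrow> agree S n x y \<Longrightarrow> agree UNIV n (A x) (A y)"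
proof -
  have "\<forall>x. \<exists>a. x \<in> XS S (UNIV :: 'a set) \<longrightarrow> Psi S a = x"
    unfolding XS_eq_Psi_image[OF trunc torsion_free subrng_UNIV] by auto
  then obtain A0 where A0: "\<And>x. x \<in> XS S (UNIV :: 'a set) \<Longrightarrow> Psi S (A0 x) = x" by metis
  define A where "A x n = (if n \<in> S then A0 x n else 0)" for x n
  have A: "Psi S (A x) = x" if "x \<in> XS S UNIV" for x
    using Psi_cong[OF trunc, of "A x" "A0 x"] A0[OF that] by (simp add: A_def)
  have "agree UNIV n (A x) (A y)"
    if "x \<in> XS S UNIV" "y \<in> XS S UNIV" "agree S n x y" for x y n
  proof -
    have "agree S n (A x) (A y)"
      using agree_Psi_iff[OF trunc torsion_free, of n "A x" "A y"] that by (simp add: A)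
    then show ?thesis by (simp add: agree_def A_def)
  qed
  then show ?thesis using that[of A] A by blast
qed

lemma quotient_map_Psi: "quotient_map (pow_topology S UNIV) (XS_topology S (UNIV :: 'a set)) (Psi S)"
proof -
  obtain A :: "(nat \<Rightarrow> 'a) \<Rightarrow> nat \<Rightarrow> 'a"
    where A: "\<And>x. x \<in> XS S UNIV \<Longrightarrow> Psi S (A x) = x"
    "\<And>x y n. x \<in> XS S UNIV \<Longrightarrow> y \<in> XS S UNIV \<Longrightarrow> agree S n x y \<Longrightarrow> agree UNIV n (A x) (A y)"
    using ex_Psi_section by metis
  show ?thesis
  proof (rule quotient_map_agreement[OF agreement_pow_topology agreement_XS_topology, where g = "\<lambda>x. restrict (A x) S"])
    show "Psi S x \<in> topspace (XS_topology S (UNIV :: 'a set))" for x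
      using XS_eq_Psi_image[OF trunc torsion_free subrng_UNIV] by auto
    show "agree S n (Psi S x) (Psi S y)" if "agree S n x y" for n and x y :: "nat \<Rightarrow> 'a"
      using that by (simp add: agree_Psi_iff[OF trunc torsion_free])
    show "restrict (A x) S \<in> topspace (pow_topology S UNIV)" for x by auto
    show "agree S n (restrict (A x) S) (restrict (A y) S)"
      if "x \<in> topspace (XS_topology S UNIV)" "y \<in> topspace (XS_topology S UNIV)" "agree S n x y" for n x y
      using A(2)[of x y n] that by (simp add: agree_def)
    show "Psi S (restrict (A x) S) = x" if "x \<in> topspace (XS_topology S UNIV)" for x
      using Psi_cong[OF trunc, of "restrict (A x) S" "A x"] A(1) that by simp
  qed
qed

lemma quotient_map_ghost:
  "quotient_map Uhat_topology (XS_topology S (UNIV :: 'a set)) (ghost S)"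
proof -
  obtain A :: "(nat \<Rightarrow> 'a) \<Rightarrow> nat \<Rightarrow> 'a"
    where A: "\<And>x. x \<in> XS S UNIV \<Longrightarrow> Psi S (A x) = x"
    "\<And>x y n. x \<in> XS S UNIV \<Longrightarrow> y \<in> XS S UNIV \<Longrightarrow> agree S n x y \<Longrightarrow> agree UNIV n (A x) (A y)"
    using ex_Psi_section by metis
  show ?thesis
  proof (rule quotient_map_agreement[OF agreement_Uhat_topology agreement_XS_topology, where g = "\<lambda>x. Wprod (A x)"])
    show "agree S n (ghost S P) (ghost S Q)"
      if "P \<in> topspace Uhat_topology" "Q \<in> topspace Uhat_topology" "fps_agree n P Q"
      for n and P Q :: "'a unitization fps"
      using that by (intro agree_ghost S_pos) auto
    show "fps_agree n (Wprod (A x)) (Wprod (A y))"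
      if "x \<in> topspace (XS_topology S UNIV)" "y \<in> topspace (XS_topology S UNIV)" "agree S n x y" for n x y
      using A(2)[of x y n] that unfolding fps_agree_Wprod_iff by (simp add: agree_def)
    show "ghost S (Wprod (A x)) = x" if "x \<in> topspace (XS_topology S UNIV)" for x
      using A(1) that by (simp add: ghost_Wprod[OF S_pos])
  qed (simp_all add: ghost_mem_XS Wprod_mem_Uhat)
qed

lemma quotient_map_pow_map:
  "quotient_map (pow_topology S UNIV) (pow_topology S UNIV) (pow_map S \<pi>)"
proof -
  obtain s where s: "\<And>y. \<pi> (s y) = y" using surj_pi by (metis surj_f_inv_f)
  show ?thesis
    by (rule quotient_map_agreement[OF agreement_pow_topology agreement_pow_topology, where g = "pow_map S s"])
       (auto simp: pow_map_def agree_def s fun_eq_iff PiE_def extensional_def)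
qed

lemma quotient_map_Uhat_map: "quotient_map Uhat_topology Uhat_topology (Uhat_map \<pi>)"
proof -
  obtain s where s: "\<And>y. \<pi> (s y) = y" using surj_pi by (metis surj_f_inv_f)
  define g where "g Q = Abs_fps (\<lambda>n. if n = 0 then 1 else emb (s (ring_part (fps_nth Q n))))" for Q
  have g: "g Q \<in> carrier Uhat" for Q by (simp add: g_def carrier_Uhat_iff)
  show ?thesis
  proof (rule quotient_map_agreement[OF agreement_Uhat_topology agreement_Uhat_topology, where g = g])
    show "Uhat_map \<pi> (g Q) = Q" if "Q \<in> topspace Uhat_topology" for Q
    proof (rule Uhat_eqI[OF Uhat_map_mem[OF g]])
      show "ring_part (fps_nth (Uhat_map \<pi> (g Q)) n) = ring_part (fps_nth Q n)" if "n > 0" for n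
        using that by (simp add: g_def s)
    qed (use that in simp)
    show "fps_agree n (g P) (g Q)" if "fps_agree n P Q" for n P Q
      using that by (simp add: agree_def g_def)
  qed (simp_all add: g Uhat_map_mem agree_def)
qed

lemma quotient_map_UhatS_proj:
  "quotient_map Uhat_topology (UhatS_topology S) (UhatS_proj S :: 'r unitization fps \<Rightarrow> _)"
  unfolding UhatS_topology_def by (rule quotient_map_quotient_topology)

theorem ex1_psi:
  "\<exists>!\<psi>. \<psi> \<in> extensional (S \<rightarrow>\<^sub>E (UNIV :: 'r set))
    \<and> homeomorphic_map (pow_topology S (UNIV :: 'r set)) (E_topology S I) \<psi>
    \<and> (\<forall>a \<in> S \<rightarrow>\<^sub>E (UNIV :: 'a set). \<psi> (pow_map S \<pi> a) = E_proj S I (Psi S a))"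
proof -
  have "\<exists>!\<psi>. \<psi> \<in> extensional (topspace (pow_topology S (UNIV :: 'r set)))
    \<and> homeomorphic_map (pow_topology S (UNIV :: 'r set)) (E_topology S I) \<psi>
    \<and> (\<forall>a \<in> topspace (pow_topology S (UNIV :: 'a set)). \<psi> (pow_map S \<pi> a) = (E_proj S I \<circ> Psi S) a)"
  proof (rule quotient_maps_with_same_fibres)
    show "quotient_map (pow_topology S UNIV) (pow_topology S UNIV) (pow_map S \<pi>)"
      by (rule quotient_map_pow_map)
    show "quotient_map (pow_topology S UNIV) (E_topology S I) (E_proj S I \<circ> Psi S)"
      by (rule quotient_map_compose[OF quotient_map_Psi quotient_map_E_proj])
    show "pow_map S \<pi> a = pow_map S \<pi> b \<longleftrightarrow> (E_proj S I \<circ> Psi S) a = (E_proj S I \<circ> Psi S) b" for a b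
      unfolding comp_def E_proj_Psi_eq_iff by (auto simp: pow_map_def fun_eq_iff restrict_def)
  qed
  then show ?thesis by simp
qed

theorem ex1_nu:
  "\<exists>!\<nu>. \<nu> \<in> extensional (carrier (UhatS S :: 'r unitization fps set monoid))
    \<and> \<nu> \<in> iso (UhatS S) (E_group S I)
    \<and> homeomorphic_map (UhatS_topology S) (E_topology S I) \<nu>
    \<and> (\<forall>C \<in> carrier (UhatS S :: 'a unitization fps set monoid).
          \<nu> (UhatS_map S \<pi> C) = E_proj S I (muS S C))"
proof -
  let ?f = "UhatS_proj S \<circ> Uhat_map \<pi>" and ?g = "E_proj S I \<circ> ghost S"
  have f: "quotient_map Uhat_topology (UhatS_topology S) ?f"
    by (rule quotient_map_compose[OF quotient_map_Uhat_map quotient_map_UhatS_proj])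
  have g: "quotient_map Uhat_topology (E_topology S I) ?g"
    by (rule quotient_map_compose[OF quotient_map_ghost quotient_map_E_proj])
  have ts: "topspace (UhatS_topology S :: 'r unitization fps set topology) = carrier (UhatS S)"
    using quotient_imp_surjective_map[OF quotient_map_UhatS_proj] UhatS_proj_image by simp
  have tE: "topspace (E_topology S I) = carrier (E_group S I)"
    using quotient_imp_surjective_map[OF quotient_map_E_proj] E_proj_image by simp
  have surj: "?f ` carrier Uhat = carrier (UhatS S)"
    using quotient_imp_surjective_map[OF f] ts by simp
  have fhom: "?f \<in> hom Uhat (UhatS S)"
    using hom_compose[OF group_hom.homh[OF group_hom_Uhat_map] UhatS_proj_hom] .
  have ghom: "?g \<in> hom Uhat (E_group S I)"
    using E_proj_hom by (simp add: comp_def)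
  have ex1: "\<exists>!\<nu>. \<nu> \<in> extensional (topspace (UhatS_topology S :: 'r unitization fps set topology))
      \<and> homeomorphic_map (UhatS_topology S) (E_topology S I) \<nu>
      \<and> (\<forall>P \<in> topspace (Uhat_topology :: 'a unitization fps topology). \<nu> (?f P) = ?g P)"
    using f g by (rule quotient_maps_with_same_fibres) (simp add: UhatS_proj_Uhat_map_eq_iff)
  have iso: "\<nu> \<in> iso (UhatS S) (E_group S I)"
    if hm: "homeomorphic_map (UhatS_topology S) (E_topology S I) \<nu>"
      and eq: "\<forall>P \<in> carrier Uhat. \<nu> (?f P) = ?g P" for \<nu>
  proof -
    have "bij_betw \<nu> (carrier (UhatS S)) (carrier (E_group S I))"
      using hm unfolding homeomorphic_eq_everything_map ts tE by (simp add: bij_betw_def)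
    moreover have "\<nu> \<in> hom (UhatS S) (E_group S I)"
    proof (rule homI)
      fix x :: "'r unitization fps set"
      assume "x \<in> carrier (UhatS S)"
      then show "\<nu> x \<in> carrier (E_group S I)" using calculation by (auto simp: bij_betw_def)
    next
      fix x y :: "'r unitization fps set"
      assume "x \<in> carrier (UhatS S)" "y \<in> carrier (UhatS S)"
      then obtain P Q where P: "P \<in> carrier Uhat" "x = ?f P" and Q: "Q \<in> carrier Uhat" "y = ?f Q"
        unfolding surj[symmetric] by blast
      have "\<nu> (x \<otimes>\<^bsub>UhatS S\<^esub> y) = \<nu> (?f (P \<otimes>\<^bsub>Uhat\<^esub> Q))"
        by (simp only: P(2) Q(2) hom_mult[OF fhom P(1) Q(1)])
      also have "\<dots> = ?g (P \<otimes>\<^bsub>Uhat\<^esub> Q)" using eq P(1) Q(1) by (metis Uhat.m_closed)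
      also have "\<dots> = ?g P \<otimes>\<^bsub>E_group S I\<^esub> ?g Q" by (rule hom_mult[OF ghom P(1) Q(1)])
      also have "\<dots> = \<nu> x \<otimes>\<^bsub>E_group S I\<^esub> \<nu> y" using eq P Q by metis
      finally show "\<nu> (x \<otimes>\<^bsub>UhatS S\<^esub> y) = \<nu> x \<otimes>\<^bsub>E_group S I\<^esub> \<nu> y" .
    qed
    ultimately show ?thesis by (simp add: iso_def)
  qed
  have key: "(\<forall>C \<in> carrier (UhatS S :: 'a unitization fps set monoid).
          \<nu> (UhatS_map S \<pi> C) = E_proj S I (muS S C))
      \<longleftrightarrow> (\<forall>P \<in> carrier Uhat. \<nu> (?f P) = ?g P)" for \<nu>
    unfolding torsion_free_presentation.UhatS_proj_image[OF presented_by_itself, symmetric]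
    by (simp add: UhatS_map_proj muS_proj)
  have "(\<nu> \<in> extensional (carrier (UhatS S)) \<and> \<nu> \<in> iso (UhatS S) (E_group S I)
      \<and> homeomorphic_map (UhatS_topology S) (E_topology S I) \<nu>
      \<and> (\<forall>C \<in> carrier (UhatS S :: 'a unitization fps set monoid).
            \<nu> (UhatS_map S \<pi> C) = E_proj S I (muS S C)))
    \<longleftrightarrow> (\<nu> \<in> extensional (topspace (UhatS_topology S :: 'r unitization fps set topology))
      \<and> homeomorphic_map (UhatS_topology S) (E_topology S I) \<nu>
      \<and> (\<forall>P \<in> topspace Uhat_topology. \<nu> (?f P) = ?g P))" for \<nu>
    unfolding key ts topspace_Uhat_topology by (intro iffI conjI; elim conjE; (rule iso)?; assumption)
  then show ?thesis using ex1 by presburger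
qed

end

theorem theorem2p4:
  fixes S :: "nat set" and I :: "'a::comm_ring set" and \<pi> :: "'a \<Rightarrow> 'r::comm_ring"
  assumes "truncation_set S"
    and "presentation I \<pi>"
    and "no_torsion S (UNIV :: 'a set)"
  shows "(\<exists>!\<psi>. \<psi> \<in> extensional (S \<rightarrow>\<^sub>E (UNIV :: 'r set))
              \<and> homeomorphic_map (pow_topology S (UNIV :: 'r set)) (E_topology S I) \<psi>
              \<and> (\<forall>a \<in> S \<rightarrow>\<^sub>E (UNIV :: 'a set). \<psi> (pow_map S \<pi> a) = E_proj S I (Psi S a)))
       \<and> (\<exists>!\<nu>. \<nu> \<in> extensional (carrier (UhatS S :: 'r unitization fps set monoid))
              \<and> \<nu> \<in> iso (UhatS S) (E_group S I)
              \<and> homeomorphic_map (UhatS_topology S) (E_topology S I) \<nu>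
              \<and> (\<forall>C \<in> carrier (UhatS S :: 'a unitization fps set monoid).
                    \<nu> (UhatS_map S \<pi> C) = E_proj S I (muS S C)))"
proof -
  interpret torsion_free_presentation S I \<pi>
    using assms by unfold_locales
  show ?thesis using ex1_psi ex1_nu by (rule conjI)
qed

end
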